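(* Let $\Bbbk$ be a field and $0\ne v\in\Bbbk$ with $[n]!\ne0$ in $\Bbbk$. Let $\alpha,\beta$ be $1$-factors of the same length, which is at most $n$, each with $m$ pairings. Then $$\pi_{\alpha,\beta}=\frac{\langle\eta(\alpha),\mu(\beta)\rangle}{\langle\mu(\beta),\mu(\beta)\rangle}=\begin{cases}\displaystyle\prod_{j=1}^m\frac{[s'_j]}{[s_j][s_j+1]}&\text{if }\beta\text{ is }\alpha\text{-compatible},\\0&\text{otherwise,}\end{cases}$$ where $s_j=s_j(\beta)$ and $s'_j=s'_j(\alpha,\beta)$. In the nonzero case, the product $\prod_{j=1}^m\frac{[s'_j]}{[s_j][s_j+1]}$ simplifies to the reciprocal of a product of quantum integers, up to sign.
   Context: Quantum integers: for $k\ge0$, $[k]=\sum_{t=0}^{k-1}v^{k-1-2t}\in\Bbbk$, $[-k]=-[k]$, $[k]!=[1][2]\cdots[k]$, $[0]!=1$. $V$ is the two-dimensional space with basis $y_1,y_{-1}$ and operators $Fy_1=y_{-1}$, $Fy_{-1}=0$, $Ky_{\pm1}=v^{\pm1}y_{\pm1}$. On $V^{\otimes m}$, $F$ acts as $\sum_{j=1}^m1^{\otimes(j-1)}\otimes F\otimes(K^{-1})^{\otimes(m-j)}$; $y_{i_1}\otimes\cdots\otimes y_{i_m}$ ($i_j\in\{\pm1\}$) has weight $\sum_ji_j$. ($V^{\otimes0}=\Bbbk$, of weight $0$, with $F=0$.) $\langle-,-\rangle$ is the symmetric bilinear form on $V^{\otimes m}$ for which the $y_{i_1}\otimes\cdots\otimes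 y_{i_m}$ are orthonormal. For $b\in V^{\otimes(m-1)}$ of weight $i_b$, $\Phi_1(b)=b\otimes y_1$ and $\Phi_2(b)=[i_b]\,b\otimes y_{-1}-v^{i_b}Fb\otimes y_1$. A $1$-factor of length $l$ is a sequence $\alpha=(\alpha_1,\dots,\alpha_l)$ with $\alpha_i=\pm1$ and all partial sums $\alpha_1+\cdots+\alpha_i\ge0$. If $\alpha_i=1$ and $j$ is the smallest index with $i<j\le l$ and $\alpha_i+\cdots+\alpha_j=0$, then $(i,j)$ is a pairing of $\alpha$; unpaired indices are called defects. $\mu(\alpha)=\Upsilon_l\cdots\Upsilon_1(1)\in V^{\otimes l}$, where $\Upsilon_i=\Phi_1$ if $\alpha_i=1$ and $\Upsilon_i=\Phi_2$ if $\alpha_i=-1$. Under the hypothesis $[n]!\ne0$, the vectors $\mu(\beta)$ for $\beta$ of a given length $\le n$ are non-isotropic and pairwise orthogonal. $\eta(\alpha)\in V^{\otimes l}$ is the tensor product, in order, of a factor $y_1$ for each defect and of nested links; explicitly: $\eta(\emptyset)=1$; if index $1$ is a defect, $\eta(\alpha)=y_1\otimes\eta(\alpha_2,\dots,\alpha_l)$; if $1$ is paired with $j$, $\eta(\alpha)=\Psi(\eta(\alpha_2,\dots,\alpha_{j-1}))\otimes\eta(\alpha_{j+1},\dots,\alpha_l)$, where $\Psi(b)=y_1\otimes b\otimes y_{-1}-v\,y_{-1}\otimes b\otimes y_1$. The coefficients $\pi_{\alpha,\beta}\in\Bbbk$ are the transition coefficients in $\eta(\alpha)=\sum_\beta\pi_{\alpha,\beta}\mu(\beta)$,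 the sum being over $1$-factors $\beta$ with the same length and the same number of pairings as $\alpha$. $\beta$ is $\alpha$-compatible if for every pairing in $\alpha$ the corresponding entries of $\beta$ have opposite signs. Let $i_1<\dots<i_m$ be the positions of the $-1$ entries of $\beta$, and $s_j=s_j(\beta)=\beta_1+\cdots+\beta_{i_j-1}$. Define $s'_j(\alpha,\beta)=-s_j$ if $\alpha_{i_j}=1$ and $s'_j(\alpha,\beta)=s_j+1$ if $\alpha_{i_j}=-1$. *)

theory Defs
  imports Complex_Main
begin

section \<open>Quantum integers\<close>

definition qint :: "'a::field \<Rightarrow> int \<Rightarrow> 'a" where
  "qint v k =
     (if 0 \<le> k then (\<Sum>t<nat k. v powi (k - 1 - 2 * int t))
      else - (\<Sum>t<nat (- k). v powi (- k - 1 - 2 * int t)))"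

definition qfact :: "'a::field \<Rightarrow> nat \<Rightarrow> 'a" where
  "qfact v n = (\<Prod>k=1..n. qint v (int k))"


section \<open>Tensor powers of $V$\<close>

text \<open>
  A word \<open>[i\<^sub>1, \<dots>, i\<^sub>m]\<close> with entries \<open>\<plusminus>1\<close> stands for the basis vector
  \<open>y\<^bsub>i\<^sub>1\<^esub> \<otimes> \<dots> \<otimes> y\<^bsub>i\<^sub>m\<^esub>\<close>, and a vector is its coordinate function on words.  The \<open>m\<close>-th tensor
  power consists of the functions vanishing outside \<open>words m\<close>.  All powers live in the one type
  \<open>int list \<Rightarrow> 'a\<close>, on which the tensor product is that of the tensor algebra.
\<close>

definition words :: "nat \<Rightarrow> int list set" where
  "words m = {w. length w = m \<and> set w \<subseteq> {1, -1}}"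

definition tensor_power :: "nat \<Rightarrow> (int list \<Rightarrow> 'a::field) set" where
  "tensor_power m = {f. \<forall>w. w \<notin> words m \<longrightarrow> f w = 0}"

definition yvec :: "int list \<Rightarrow> int list \<Rightarrow> 'a::field" where
  "yvec w = (\<lambda>u. if u = w then 1 else 0)"

definition tensor ::
    "(int list \<Rightarrow> 'a::field) \<Rightarrow> (int list \<Rightarrow> 'a) \<Rightarrow> int list \<Rightarrow> 'a" (infixr \<open>\<otimes>\<^sub>V\<close> 70) where
  "f \<otimes>\<^sub>V g = (\<lambda>u. \<Sum>k\<le>length u. f (take k u) * g (drop k u))"

text \<open>The bilinear form on the \<open>m\<close>-th tensor power for which the words are orthonormal.\<close>

definition form :: "nat \<Rightarrow> (int list \<Rightarrow> 'a::field) \<Rightarrow> (int list \<Rightarrow> 'a) \<Rightarrow> 'a" where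
  "form m f g = (\<Sum>w\<in>words m. f w * g w)"

definition has_weight :: "(int list \<Rightarrow> 'a::field) \<Rightarrow> int \<Rightarrow> bool" where
  "has_weight f i \<longleftrightarrow> (\<forall>w. f w \<noteq> 0 \<longrightarrow> sum_list w = i)"

lemma tensor_yvec: "(yvec u \<otimes>\<^sub>V yvec w :: int list \<Rightarrow> 'a::field) = yvec (u @ w)"
proof
  fix z :: "int list"
  have "(yvec u \<otimes>\<^sub>V yvec w :: int list \<Rightarrow> 'a) z
      = (\<Sum>k\<le>length z. if k = length u \<and> z = u @ w then 1 else 0)"
    unfolding tensor_def yvec_def by (intro sum.cong refl) auto
  also have "\<dots> = yvec (u @ w) z"
    by (cases "z = u @ w") (auto simp: yvec_def)
  finally show "(yvec u \<otimes>\<^sub>V yvec w :: int list \<Rightarrow> 'a) z = yvec (u @ w) z" .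
qed


section \<open>The operator $F$\<close>

text \<open>
  An operator \<open>A\<close> on \<open>V\<close> is given by its matrix: \<open>A a b\<close> is the coefficient of \<open>y\<^sub>a\<close> in \<open>A y\<^sub>b\<close>, for
  \<open>a, b \<in> {1, -1}\<close>.
\<close>

definition V_id :: "int \<Rightarrow> int \<Rightarrow> 'a::field" where
  "V_id a b = (if a = b then 1 else 0)"

definition V_F :: "int \<Rightarrow> int \<Rightarrow> 'a::field" where
  "V_F a b = (if a = -1 \<and> b = 1 then 1 else 0)"

definition V_Kinv :: "'a::field \<Rightarrow> int \<Rightarrow> int \<Rightarrow> 'a" where
  "V_Kinv v a b = (if a = b then inverse (v powi b) else 0)"

text \<open>The operator \<open>A\<^sub>1 \<otimes> \<dots> \<otimes> A\<^sub>m\<close> on the \<open>m\<close>-th tensor power.\<close>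

definition tensor_op ::
    "(int \<Rightarrow> int \<Rightarrow> 'a::field) list \<Rightarrow> (int list \<Rightarrow> 'a) \<Rightarrow> int list \<Rightarrow> 'a" where
  "tensor_op As f = (\<lambda>u.
     if u \<in> words (length As)
     then \<Sum>w\<in>words (length As). (\<Prod>i<length As. (As ! i) (u ! i) (w ! i)) * f w
     else 0)"

text \<open>Here the degree \<open>m\<close> is read off the word \<open>u\<close>, so that \<open>F\<close> acts on each tensor power.\<close>

definition F_op :: "'a::field \<Rightarrow> (int list \<Rightarrow> 'a) \<Rightarrow> int list \<Rightarrow> 'a" where
  "F_op v f = (\<lambda>u. let m = length u in
     \<Sum>j=1..m. tensor_op (replicate (j - 1) V_id @ [V_F] @ replicate (m - j) (V_Kinv v)) f u)"


section \<open>1-factors\<close>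

text \<open>Positions in lists are counted from \<open>0\<close>.\<close>

definition one_factor :: "int list \<Rightarrow> bool" where
  "one_factor \<alpha> \<longleftrightarrow> set \<alpha> \<subseteq> {1, -1} \<and> (\<forall>k\<le>length \<alpha>. 0 \<le> sum_list (take k \<alpha>))"

definition pairings :: "int list \<Rightarrow> (nat \<times> nat) set" where
  "pairings \<alpha> = {(i, j). i < j \<and> j < length \<alpha> \<and> \<alpha> ! i = 1 \<and>
     (\<Sum>k=i..j. \<alpha> ! k) = 0 \<and> (\<forall>j'. i < j' \<and> j' < j \<longrightarrow> (\<Sum>k=i..j'. \<alpha> ! k) \<noteq> 0)}"

definition compatible :: "int list \<Rightarrow> int list \<Rightarrow> bool" where
  "compatible \<alpha> \<beta> \<longleftrightarrow> (\<forall>(i, j)\<in>pairings \<alpha>. \<beta> ! i = - \<beta> ! j)"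


section \<open>The two families of vectors\<close>

text \<open>\<open>\<Phi>\<^sub>2\<close> takes the weight \<open>i\<close> of its argument \<open>b\<close> as a parameter.\<close>

definition Phi1 :: "(int list \<Rightarrow> 'a::field) \<Rightarrow> int list \<Rightarrow> 'a" where
  "Phi1 b = b \<otimes>\<^sub>V yvec [1]"

definition Phi2 :: "'a::field \<Rightarrow> int \<Rightarrow> (int list \<Rightarrow> 'a) \<Rightarrow> int list \<Rightarrow> 'a" where
  "Phi2 v i b = (\<lambda>u. qint v i * (b \<otimes>\<^sub>V yvec [-1]) u - v powi i * (F_op v b \<otimes>\<^sub>V yvec [1]) u)"

text \<open>
  In step \<open>i\<close> the current vector has weight \<open>sum_list (take i \<alpha>)\<close>; see lemma \<open>mu_homogeneous\<close>.
\<close>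

definition mu :: "'a::field \<Rightarrow> int list \<Rightarrow> int list \<Rightarrow> 'a" where
  "mu v \<alpha> = fold (\<lambda>i b. if \<alpha> ! i = 1 then Phi1 b else Phi2 v (sum_list (take i \<alpha>)) b)
     [0..<length \<alpha>] (yvec [])"

definition Psi :: "'a::field \<Rightarrow> (int list \<Rightarrow> 'a) \<Rightarrow> int list \<Rightarrow> 'a" where
  "Psi v b = (\<lambda>u. (yvec [1] \<otimes>\<^sub>V b \<otimes>\<^sub>V yvec [-1]) u - v * (yvec [-1] \<otimes>\<^sub>V b \<otimes>\<^sub>V yvec [1]) u)"

text \<open>If position \<open>0\<close> is paired with \<open>j\<close>, the entries strictly between them are \<open>take (j - 1) as\<close>.\<close>

fun eta :: "'a::field \<Rightarrow> int list \<Rightarrow> int list \<Rightarrow> 'a" where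
  "eta v [] = yvec []"
| "eta v (a # as) =
     (if \<exists>j. (0, j) \<in> pairings (a # as)
      then let j = (THE j. (0, j) \<in> pairings (a # as))
           in Psi v (eta v (take (j - 1) as)) \<otimes>\<^sub>V eta v (drop j as)
      else yvec [1] \<otimes>\<^sub>V eta v as)"


subsection \<open>Degree and weight of \<open>mu\<close>\<close>

lemma tensor_snoc_yvec:
  "(f \<otimes>\<^sub>V yvec [a]) u = (if u \<noteq> [] \<and> last u = a then f (butlast u) else (0::'a::field))"
proof (cases u rule: rev_cases)
  case Nil
  then show ?thesis by (simp add: tensor_def yvec_def)
next
  case (snoc w b)
  have "(f \<otimes>\<^sub>V yvec [a]) u = (\<Sum>k\<le>length u. if k = length w then f w * yvec [a] [b] else 0)"
    unfolding tensor_def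
  proof (intro sum.cong refl)
    fix k assume "k \<in> {..length u}"
    then consider "k < length w" | "k = length w" | "k = Suc (length w)"
      using snoc by fastforce
    then show "f (take k u) * yvec [a] (drop k u) = (if k = length w then f w * yvec [a] [b] else 0)"
      by cases (auto simp: snoc yvec_def)
  qed
  then show ?thesis by (simp add: snoc yvec_def)
qed

lemma finite_words: "finite (words m)"
  unfolding words_def
  by (rule finite_subset[OF _ finite_lists_length_eq[of "{1, -1::int}" m]]) auto

lemma F_op_nonzero:
  assumes "F_op v f u \<noteq> (0::'a::field)"
  obtains w where "f w \<noteq> 0" "u \<in> words (length u)" "w \<in> words (length u)" "sum_list w = sum_list u + 2"
proof -
  define m where "m = length u"
  define As where "As j = replicate (j - 1) V_id @ [V_F] @ replicate (m - j) (V_Kinv v)" for j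
  have "(\<Sum>j=1..m. tensor_op (As j) f u) \<noteq> 0"
    using assms by (simp add: F_op_def m_def As_def Let_def)
  then obtain j where j: "j \<in> {1..m}" "tensor_op (As j) f u \<noteq> 0"
    by (meson sum.neutral)
  have len: "length (As j) = m" using j by (simp add: As_def)
  have um: "u \<in> words m" using j(2) by (auto simp: tensor_op_def len split: if_splits)
  have "(\<Sum>w\<in>words m. (\<Prod>i<m. (As j ! i) (u ! i) (w ! i)) * f w) \<noteq> 0"
    using j(2) um by (simp add: tensor_op_def len)
  then obtain w where w: "w \<in> words m" "(\<Prod>i<m. (As j ! i) (u ! i) (w ! i)) \<noteq> 0" "f w \<noteq> 0"
    by (metis (no_types, lifting) mult_zero_left mult_zero_right sum.neutral)
  have nz: "(As j ! i) (u ! i) (w ! i) \<noteq> 0" if "i < m" for i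
    using w(2) that by auto
  have eq: "w ! i = u ! i + (if i = j - 1 then 2 else 0)" if i: "i < m" for i
  proof -
    consider "i < j - 1" | "i = j - 1" | "i \<ge> j" by linarith
    then show ?thesis
    proof cases
      case 1
      then have "As j ! i = V_id" by (simp add: As_def nth_append)
      then show ?thesis using nz[OF i] 1 by (auto simp: V_id_def split: if_splits)
    next
      case 2
      then have "As j ! i = V_F" by (simp add: As_def nth_append)
      then show ?thesis using nz[OF i] 2 by (auto simp: V_F_def split: if_splits)
    next
      case 3
      moreover have "i - (j - 1) = Suc (i - j)" using 3 j(1) by auto
      moreover have "\<not> i < j - 1" using 3 j(1) by auto
      ultimately have "As j ! i = V_Kinv v" using i by (simp add: As_def nth_append)
      then show ?thesis using nz[OF i] 3 j(1) by (auto simp: V_Kinv_def split: if_splits)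
    qed
  qed
  have lw: "length w = m" using w(1) by (simp add: words_def)
  have "sum_list w = (\<Sum>i<m. w ! i)" by (simp add: sum_list_sum_nth lw lessThan_atLeast0)
  also have "\<dots> = (\<Sum>i<m. u ! i + (if i = j - 1 then 2 else 0))" using eq by simp
  also have "\<dots> = (\<Sum>i<m. u ! i) + 2" using j(1) by (auto simp: sum.distrib)
  also have "(\<Sum>i<m. u ! i) = sum_list u"
    by (simp add: sum_list_sum_nth m_def lessThan_atLeast0)
  finally show ?thesis using that w um m_def by blast
qed

lemma words_butlast:
  "u \<noteq> [] \<Longrightarrow> butlast u \<in> words m \<Longrightarrow> last u \<in> {1, -1} \<Longrightarrow> u \<in> words (Suc m)"
  by (cases u rule: rev_cases) (auto simp: words_def)

lemma sum_list_butlast_last: "u \<noteq> [] \<Longrightarrow> sum_list u = sum_list (butlast u) + (last u :: int)"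
  by (cases u rule: rev_cases) auto

lemma Phi1_homogeneous:
  assumes "b \<in> tensor_power m" "has_weight b i"
  shows "Phi1 b \<in> tensor_power (Suc m)" "has_weight (Phi1 b) (i + 1)"
proof -
  have "u \<in> words (Suc m) \<and> sum_list u = i + 1" if "Phi1 b u \<noteq> 0" for u
  proof -
    from that have u: "u \<noteq> []" "last u = 1" "b (butlast u) \<noteq> 0"
      by (auto simp: Phi1_def tensor_snoc_yvec split: if_splits)
    then show ?thesis
      using assms words_butlast[of u m] sum_list_butlast_last[of u]
      by (auto simp: tensor_power_def has_weight_def)
  qed
  then show "Phi1 b \<in> tensor_power (Suc m)" "has_weight (Phi1 b) (i + 1)"
    by (auto simp: tensor_power_def has_weight_def)
qed

lemma Phi2_homogeneous:
  assumes "b \<in> tensor_power m" "has_weight b i"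
  shows "Phi2 v i b \<in> tensor_power (Suc m)" "has_weight (Phi2 v i b) (i - 1)"
proof -
  have "u \<in> words (Suc m) \<and> sum_list u = i - 1" if "Phi2 v i b u \<noteq> 0" for u
  proof -
    from that consider "(b \<otimes>\<^sub>V yvec [-1]) u \<noteq> 0" | "(F_op v b \<otimes>\<^sub>V yvec [1]) u \<noteq> 0"
      by (cases "(b \<otimes>\<^sub>V yvec [-1]) u = 0") (auto simp: Phi2_def)
    then show ?thesis
    proof cases
      case 1
      then have u: "u \<noteq> []" "last u = -1" "b (butlast u) \<noteq> 0"
        by (auto simp: tensor_snoc_yvec split: if_splits)
      then show ?thesis
        using assms words_butlast[of u m] sum_list_butlast_last[of u]
        by (auto simp: tensor_power_def has_weight_def)
    next
      case 2
      then have u: "u \<noteq> []" "last u = 1" "F_op v b (butlast u) \<noteq> 0"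
        by (auto simp: tensor_snoc_yvec split: if_splits)
      from F_op_nonzero[OF u(3)] obtain w where w: "b w \<noteq> 0"
        "butlast u \<in> words (length (butlast u))" "w \<in> words (length (butlast u))"
        "sum_list w = sum_list (butlast u) + 2" by blast
      have "w \<in> words m" using w(1) assms(1) by (auto simp: tensor_power_def)
      then have "length (butlast u) = m" using w(3) by (auto simp: words_def)
      moreover have "sum_list w = i" using w(1) assms(2) by (auto simp: has_weight_def)
      ultimately show ?thesis
        using u w words_butlast[of u m] sum_list_butlast_last[of u] by auto
    qed
  qed
  then show "Phi2 v i b \<in> tensor_power (Suc m)" "has_weight (Phi2 v i b) (i - 1)"
    by (auto simp: tensor_power_def has_weight_def)
qed

lemma mu_Nil: "mu v [] = yvec []"
  by (simp add: mu_def)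

lemma mu_snoc:
  "mu v (\<alpha> @ [a]) = (if a = 1 then Phi1 (mu v \<alpha>) else Phi2 v (sum_list \<alpha>) (mu v \<alpha>))"
proof -
  define g where "g \<alpha> i b = (if \<alpha> ! i = 1 then Phi1 b else Phi2 v (sum_list (take i \<alpha>)) b)"
    for \<alpha> :: "int list" and i b
  have mu_g: "mu v \<alpha> = fold (g \<alpha>) [0..<length \<alpha>] (yvec [])" for \<alpha>
    by (simp add: mu_def g_def[abs_def])
  have "fold (g (\<alpha> @ [a])) [0..<length \<alpha>] (yvec []) = mu v \<alpha>"
    unfolding mu_g by (intro fold_cong refl) (auto simp: g_def nth_append fun_eq_iff)
  then have "mu v (\<alpha> @ [a]) = g (\<alpha> @ [a]) (length \<alpha>) (mu v \<alpha>)"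
    by (simp add: mu_g[of "\<alpha> @ [a]"])
  then show ?thesis by (simp add: g_def)
qed

lemma mu_homogeneous:
  assumes "set \<alpha> \<subseteq> {1, -1}"
  shows "mu v \<alpha> \<in> tensor_power (length \<alpha>) \<and> has_weight (mu v \<alpha>) (sum_list \<alpha>)"
  using assms
proof (induction \<alpha> rule: rev_induct)
  case Nil
  then show ?case
    by (auto simp: mu_Nil tensor_power_def words_def has_weight_def yvec_def)
next
  case (snoc a \<alpha>)
  then have IH: "mu v \<alpha> \<in> tensor_power (length \<alpha>)" "has_weight (mu v \<alpha>) (sum_list \<alpha>)"
    and a: "a = 1 \<or> a = -1" by auto
  show ?case
    using a Phi1_homogeneous[OF IH] Phi2_homogeneous[OF IH, of v] by (auto simp: mu_snoc)
qed


section \<open>Transition coefficients\<close>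

text \<open>1-factors with the same length and the same number of pairings as \<open>\<alpha>\<close>.\<close>

definition same_type :: "int list \<Rightarrow> int list set" where
  "same_type \<alpha> = {\<beta>. one_factor \<beta> \<and> length \<beta> = length \<alpha> \<and> card (pairings \<beta>) = card (pairings \<alpha>)}"

definition is_expansion :: "'a::field \<Rightarrow> int list \<Rightarrow> (int list \<Rightarrow> 'a) \<Rightarrow> bool" where
  "is_expansion v \<alpha> c \<longleftrightarrow> eta v \<alpha> = (\<lambda>w. \<Sum>\<beta>\<in>same_type \<alpha>. c \<beta> * mu v \<beta> w)"

text \<open>The coefficient of \<open>mu v \<beta>\<close> in the expansion of \<open>eta v \<alpha>\<close>, for \<open>\<beta> \<in> same_type \<alpha>\<close>.\<close>

definition trans_coeff :: "'a::field \<Rightarrow> int list \<Rightarrow> int list \<Rightarrow> 'a" where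
  "trans_coeff v \<alpha> \<beta> = (THE x. \<exists>c. is_expansion v \<alpha> c \<and> c \<beta> = x)"


section \<open>The integers $s_j$ and $s'_j$\<close>

definition neg_positions :: "int list \<Rightarrow> nat list" where
  "neg_positions \<beta> = filter (\<lambda>i. \<beta> ! i = -1) [0..<length \<beta>]"

text \<open>
  The index \<open>j\<close> runs from \<open>1\<close> to the number of entries \<open>-1\<close> of \<open>\<beta>\<close>, which for a 1-factor is its
  number of pairings.
\<close>

definition s_seq :: "int list \<Rightarrow> nat \<Rightarrow> int" where
  "s_seq \<beta> j = sum_list (take (neg_positions \<beta> ! (j - 1)) \<beta>)"

definition s'_seq :: "int list \<Rightarrow> int list \<Rightarrow> nat \<Rightarrow> int" where
  "s'_seq \<alpha> \<beta> j =
     (if \<alpha> ! (neg_positions \<beta> ! (j - 1)) = 1 then - s_seq \<beta> j else s_seq \<beta> j + 1)"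

end

theory Submission
  imports Defs
begin

text \<open>
  Call \<open>\<cup> = y\<^sub>1 \<otimes> y\<^sub>-\<^sub>1 - v y\<^sub>-\<^sub>1 \<otimes> y\<^sub>1\<close> a cup.  In a 1-factor \<open>\<alpha>\<close> with at least one pairing, the first entry \<open>-1\<close>
  is preceded by an entry \<open>1\<close>, and \<open>eta v \<alpha>\<close> arises from the vector of the shorter 1-factor without these two
  entries by inserting a cup in their place (lemma \<open>eta_insert\<close>).  So it suffices to know what the
  insertion of a cup does to the vectors \<open>mu\<close>.  Let \<open>s\<close> be the sum of the entries to the left of the
  cup.  By lemma \<open>insert_cup_mu\<close>, inserting a cup into \<open>mu v (\<beta>' @ \<beta>'')\<close> behind \<open>\<beta>'\<close> and multiplying by
  \<open>[s+1]\<close> yields \<open>mu v (\<beta>' @ [1, -1] @ \<beta>'') - mu v (\<beta>' @ [-1, 1] @ \<beta>'')\<close>.  This is a short computation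
  when \<open>\<beta>''\<close> is empty; it persists because the cup is invariant under \<open>F\<close> and \<open>K\<close>, so that inserting it
  commutes with \<open>Phi1\<close> and \<open>Phi2\<close>.

  The two signs match the two ways in which \<open>\<beta>\<close> can be compatible with the new pairing, and \<open>\<plusminus>1/[s+1]\<close>
  is the factor \<open>[s']/([s][s+1])\<close> contributed by the new entry \<open>-1\<close>; the other pairings and the other
  factors do not change (lemmas \<open>pairings_insert\<close>, \<open>coeff_prod_insert\<close>).  Induction on the number
  of pairings gives the expansion of \<open>eta v \<alpha>\<close> with the asserted coefficients, first as a sum over all
  words of the right weight (lemma \<open>eta_expansion_words\<close>).  The words that are not 1-factors contribute
  nothing: \<open>F\<close> kills \<open>mu v \<beta>\<close> when \<open>\<beta>\<close> is a 1-factor of sum \<open>0\<close>, and therefore \<open>mu\<close> vanishes as soon as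
  a partial sum becomes negative (lemma \<open>mu_eq_0_if_not_one_factor\<close>).

  That the coefficients are unique and are given by scalar products follows from orthogonality.  The
  transpose \<open>E\<close> of \<open>F\<close> satisfies \<open>E F - v\<^sup>2 F E = v\<^bsup>1-s\<^esup> [s]\<close> in weight \<open>s\<close> and kills every \<open>mu v \<beta>\<close>
  (lemma \<open>F_transpose_mu\<close>).  Hence the vectors \<open>mu v \<beta>\<close> are orthogonal, with norm the product of
  \<open>v [s\<^sub>j] [s\<^sub>j+1]\<close> over the entries \<open>-1\<close> of \<open>\<beta>\<close> (lemma \<open>form_mu\<close>); for a 1-factor \<open>\<beta>\<close> of length at most \<open>n\<close>
  all these quantum integers are among the factors of \<open>[n]!\<close>.
\<close>

section \<open>Quantum integers\<close>

lemma qint_nonneg: "qint v (int k) = (\<Sum>t<k. v powi (int k - 1 - 2 * int t))"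
  by (simp add: qint_def)

lemma qint_0 [simp]: "qint v 0 = 0"
  by (simp add: qint_def)

lemma qint_minus: "qint v (- k) = - qint v k"
  by (auto simp: qint_def)

lemma powi_shift:
  fixes v :: "'a::field"
  assumes "v \<noteq> 0"
  shows "v powi (k + 1) = v * v powi k" "v powi (k - 1) = inverse v * v powi k"
  using assms by (simp_all add: power_int_add power_int_diff field_simps)

lemma qint_add_one_inverse_nat:
  fixes v :: "'a::field"
  assumes "v \<noteq> 0"
  shows "qint v (int k + 1) = inverse v * qint v (int k) + v powi int k"
proof -
  have "qint v (int k + 1) = (\<Sum>t<Suc k. v powi (int k - 2 * int t))"
    using qint_nonneg[of v "Suc k"] by (simp add: add.commute)
  (* the first summand is split off here, the last one in the other recursion *)
  also have "\<dots> = v powi int k + (\<Sum>t<k. v powi (int k - 2 * int (Suc t)))"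
    by (subst sum.lessThan_Suc_shift) simp
  also have "(\<Sum>t<k. v powi (int k - 2 * int (Suc t))) = inverse v * qint v (int k)"
    unfolding qint_nonneg sum_distrib_left
  proof (intro sum.cong refl)
    fix t
    have "int k - 2 * int (Suc t) = (int k - 1 - 2 * int t) - 1" by simp
    then show "v powi (int k - 2 * int (Suc t)) = inverse v * v powi (int k - 1 - 2 * int t)"
      using powi_shift(2)[OF assms, of "int k - 1 - 2 * int t"] by (simp add: algebra_simps)
  qed
  finally show ?thesis by simp
qed

lemma qint_add_one_nat:
  fixes v :: "'a::field"
  assumes "v \<noteq> 0"
  shows "qint v (int k + 1) = v * qint v (int k) + v powi (- int k)"
proof -
  have "qint v (int k + 1) = (\<Sum>t<Suc k. v powi (int k - 2 * int t))"
    using qint_nonneg[of v "Suc k"] by (simp add: add.commute)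
  also have "\<dots> = (\<Sum>t<k. v powi (int k - 2 * int t)) + v powi (- int k)"
    by simp
  also have "(\<Sum>t<k. v powi (int k - 2 * int t)) = v * qint v (int k)"
    unfolding qint_nonneg sum_distrib_left
  proof (intro sum.cong refl)
    fix t
    have "int k - 2 * int t = (int k - 1 - 2 * int t) + 1" by simp
    then show "v powi (int k - 2 * int t) = v * v powi (int k - 1 - 2 * int t)"
      using powi_shift(1)[OF assms, of "int k - 1 - 2 * int t"] by simp
  qed
  finally show ?thesis .
qed

text \<open>
  These two recursions, valid for all integers \<open>k\<close>, replace the closed formula
  \<open>(v - v\<inverse>) [k] = v\<^sup>k - v\<^sup>-\<^sup>k\<close>, which says nothing when \<open>v\<^sup>2 = 1\<close>.  Negation of \<open>k\<close>
  exchanges them.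
\<close>

lemma qint_add_one:
  fixes v :: "'a::field"
  assumes "v \<noteq> 0"
  shows "qint v (k + 1) = v * qint v k + v powi (- k)"
    and "qint v (k + 1) = inverse v * qint v k + v powi k"
proof -
  have "qint v (k + 1) = v * qint v k + v powi (- k) \<and>
        qint v (k + 1) = inverse v * qint v k + v powi k"
  proof (cases "0 \<le> k")
    case True
    then show ?thesis
      using qint_add_one_nat[OF assms, of "nat k"] qint_add_one_inverse_nat[OF assms, of "nat k"]
      by simp
  next
    case False
    define j where "j = nat (- k - 1)"
    have k: "k = - (int j + 1)" using False by (simp add: j_def)
    have "- k = int j + 1" "k = - int j - 1" by (simp_all add: k)
    then have pow: "v powi (- k) = v * v powi int j" "v powi k = inverse v * v powi (- int j)"
      using powi_shift(1)[OF assms, of "int j"] powi_shift(2)[OF assms, of "- int j"]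
      by (simp_all only:)
    have q: "qint v (k + 1) = - qint v (int j)" "qint v k = - qint v (int j + 1)"
      by (simp_all only: k qint_minus[symmetric]) simp_all
    have "qint v (k + 1) = v * qint v k + v powi (- k)"
      unfolding q pow qint_add_one_inverse_nat[OF assms, of j] using assms by (simp add: algebra_simps)
    moreover have "qint v (k + 1) = inverse v * qint v k + v powi k"
      unfolding q pow qint_add_one_nat[OF assms, of j] using assms by (simp add: algebra_simps)
    ultimately show ?thesis by blast
  qed
  then show "qint v (k + 1) = v * qint v k + v powi (- k)"
    and "qint v (k + 1) = inverse v * qint v k + v powi k" by blast+
qed

lemma qint_1 [simp]: "qint v 1 = 1"
  using qint_nonneg[of v 1] by simp

lemma qint_nonzero:
  assumes "qfact v n \<noteq> 0" "1 \<le> k" "k \<le> int n"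
  shows "qint v k \<noteq> 0"
proof -
  have "nat k \<in> {1..n}" using assms by auto
  then have "qint v (int (nat k)) \<noteq> 0" using assms(1) unfolding qfact_def by force
  then show ?thesis using assms by simp
qed

section \<open>Coordinates of \<open>F\<close>\<close>

lemma words_0 [simp]: "words 0 = {[]}"
  by (auto simp: words_def)

lemma snoc_in_words_iff [simp]: "w @ [a] \<in> words (Suc m) \<longleftrightarrow> w \<in> words m \<and> (a = 1 \<or> a = -1)"
  by (auto simp: words_def)

lemma length_words: "w \<in> words m \<Longrightarrow> length w = m"
  by (simp add: words_def)

lemma words_Suc: "words (Suc m) = (\<lambda>w. w @ [1]) ` words m \<union> (\<lambda>w. w @ [-1]) ` words m"
proof (intro equalityI subsetI)
  fix u assume u: "u \<in> words (Suc m)"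
  then show "u \<in> (\<lambda>w. w @ [1]) ` words m \<union> (\<lambda>w. w @ [-1]) ` words m"
    by (cases u rule: rev_cases) (auto simp: words_def)
qed auto

lemma sum_words_Suc:
  "(\<Sum>w\<in>words (Suc m). g w) = (\<Sum>w\<in>words m. g (w @ [1])) + (\<Sum>w\<in>words m. g (w @ [-1]))"
  unfolding words_Suc
  by (subst sum.union_disjoint)
    (auto simp: finite_words intro!: arg_cong2[where f = "(+)"] sum.reindex_cong[OF _ refl] inj_onI)

lemma tensor_op_snoc:
  assumes "u \<in> words (length As)" "a = 1 \<or> a = -1"
  shows "tensor_op (As @ [A]) f (u @ [a]) =
    A a 1 * tensor_op As (\<lambda>w. f (w @ [1])) u + A a (-1) * tensor_op As (\<lambda>w. f (w @ [-1])) u"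
proof -
  have prod: "(\<Prod>i<Suc (length As). ((As @ [A]) ! i) ((u @ [a]) ! i) ((w @ [b]) ! i)) =
      A a b * (\<Prod>i<length As. (As ! i) (u ! i) (w ! i))" if "w \<in> words (length As)" for w b
    using that assms(1) by (simp add: length_words nth_append mult.commute)
  show ?thesis
    using assms
    by (simp add: tensor_op_def sum_words_Suc prod sum_distrib_left mult.assoc del: prod.lessThan_Suc)
qed

lemma V_id_diag: "V_id a a = 1" "V_id 1 (-1) = 0" "V_id (-1) 1 = 0"
  by (simp_all add: V_id_def)

lemma tensor_op_id:
  "u \<in> words m \<Longrightarrow> tensor_op (replicate m V_id) f u = f u"
proof (induction m arbitrary: u f)
  case 0
  then show ?case by (simp add: tensor_op_def)
next
  case (Suc m)
  then obtain w a where u: "u = w @ [a]" "w \<in> words m" "a = 1 \<or> a = -1"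
    by (auto simp: words_Suc)
  show ?case
    using tensor_op_snoc[of w "replicate m V_id" a V_id f] u Suc.IH[OF u(2)]
    by (auto simp: replicate_append_same[symmetric] V_id_diag)
qed

lemma F_op_eq:
  "F_op v f u = (\<Sum>j=1..length u.
     tensor_op (replicate (j - 1) V_id @ [V_F] @ replicate (length u - j) (V_Kinv v)) f u)"
  by (simp add: F_op_def Let_def)

lemma F_op_eq_0: "u \<notin> words (length u) \<Longrightarrow> F_op v f u = 0"
  using F_op_nonzero by metis

lemma F_op_Nil [simp]: "F_op v f [] = 0"
  by (simp add: F_op_eq)

lemma F_op_cong:
  assumes "\<And>w. w \<in> words (length u) \<Longrightarrow> f w = g w"
  shows "F_op v f u = F_op v g u"
proof (cases "u = []")
  case False
  then show ?thesis
    unfolding F_op_eq tensor_op_def using assms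
    by (intro sum.cong refl if_cong arg_cong2[where f = "(*)"]) auto
qed simp

lemma F_op_linear:
  "F_op v (\<lambda>u. c * f u + d * g u) u = c * F_op v f u + d * F_op v g u"
  unfolding F_op_eq
  by (simp add: sum_distrib_left flip: sum.distrib, intro sum.cong refl)
    (auto simp: tensor_op_def sum_distrib_left algebra_simps sum.distrib)

lemma F_op_scale: "F_op v (\<lambda>u. c * f u) u = c * F_op v f u"
  using F_op_linear[of v c f 0 f u] by simp

lemma F_op_zero [simp]: "F_op v (\<lambda>u. 0) = (\<lambda>u. 0)"
  using F_op_scale[of v 0 "\<lambda>u. 0"] by auto

text \<open>
  The coproduct rule \<open>F = F \<otimes> K\<inverse> + 1 \<otimes> F\<close> on \<open>V\<^bsup>\<otimes>m\<^esup> \<otimes> V\<close>, read off in the coordinates that belong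
  to the last factor \<open>y\<^sub>a\<close>.  It fits the recursion for \<open>mu\<close>, which appends tensor factors on the
  right.
\<close>

lemma F_op_snoc_word:
  fixes v :: "'a::field"
  assumes u: "u \<in> words m" and a: "a = 1 \<or> a = -1"
  shows "F_op v f (u @ [a]) = v powi (- a) * F_op v (\<lambda>w. f (w @ [a])) u +
           (if a = -1 then f (u @ [1]) else 0)"
proof -
  let ?As = "\<lambda>j. replicate (j - 1) V_id @ [V_F] @ replicate (m - j) (V_Kinv v)"
  have len: "length u = m" using u by (rule length_words)
  have "F_op v f (u @ [a]) =
      (\<Sum>j=1..m. tensor_op (replicate (j - 1) V_id @ [V_F] @ replicate (Suc m - j) (V_Kinv v)) f (u @ [a]))
      + tensor_op (replicate m V_id @ [V_F]) f (u @ [a])"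
    by (simp add: F_op_eq len)
  also have "tensor_op (replicate m V_id @ [V_F]) f (u @ [a]) = (if a = -1 then f (u @ [1]) else 0)"
    using a u by (subst tensor_op_snoc) (auto simp: tensor_op_id V_F_def)
  also have "(\<Sum>j=1..m. tensor_op (replicate (j - 1) V_id @ [V_F] @ replicate (Suc m - j) (V_Kinv v)) f (u @ [a]))
    = (\<Sum>j=1..m. v powi (- a) * tensor_op (?As j) (\<lambda>w. f (w @ [a])) u)"
  proof (intro sum.cong refl)
    fix j assume j: "j \<in> {1..m}"
    have "replicate (j - 1) V_id @ [V_F] @ replicate (Suc m - j) (V_Kinv v) = ?As j @ [V_Kinv v]"
      using j by (simp add: Suc_diff_le replicate_append_same)
    moreover have "u \<in> words (length (?As j))" using u j by simp
    ultimately show "tensor_op (replicate (j - 1) V_id @ [V_F] @ replicate (Suc m - j) (V_Kinv v)) f (u @ [a])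
      = v powi (- a) * tensor_op (?As j) (\<lambda>w. f (w @ [a])) u"
      using a tensor_op_snoc[of u "?As j" a "V_Kinv v" f]
      by (auto simp: V_Kinv_def power_int_minus)
  qed
  finally show ?thesis by (simp add: F_op_eq len sum_distrib_left)
qed

lemma F_op_snoc1: "F_op v f (u @ [1]) = inverse v * F_op v (\<lambda>w. f (w @ [1])) u"
proof (cases "u \<in> words (length u)")
  case True
  then show ?thesis using F_op_snoc_word[of u "length u" 1 v f] by simp
next
  case False
  then have "u @ [1] \<notin> words (length (u @ [1]))" by simp
  then show ?thesis using False by (simp add: F_op_eq_0)
qed

lemma F_op_snoc_minus1:
  assumes "u \<in> words m"
  shows "F_op v f (u @ [-1]) = v * F_op v (\<lambda>w. f (w @ [-1])) u + f (u @ [1])"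
  using F_op_snoc_word[OF assms, of "-1" v f] by simp

section \<open>Vanishing of \<open>mu\<close> on words that are not 1-factors\<close>

lemma one_factor_Nil [simp]: "one_factor []"
  by (simp add: one_factor_def)

lemma one_factor_snoc:
  "one_factor (\<beta> @ [a]) \<longleftrightarrow> one_factor \<beta> \<and> (a = 1 \<or> a = -1) \<and> 0 \<le> sum_list \<beta> + a"
proof -
  have "(\<forall>k\<le>length (\<beta> @ [a]). 0 \<le> sum_list (take k (\<beta> @ [a]))) \<longleftrightarrow>
        (\<forall>k\<le>length \<beta>. 0 \<le> sum_list (take k \<beta>)) \<and> 0 \<le> sum_list \<beta> + a"
    by (auto simp: le_Suc_eq)
  then show ?thesis by (auto simp: one_factor_def)
qed

lemma one_factor_sum_nonneg: "one_factor \<beta> \<Longrightarrow> 0 \<le> sum_list \<beta>"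
  unfolding one_factor_def by (metis order_refl take_all)

lemma one_factor_set: "one_factor \<beta> \<Longrightarrow> set \<beta> \<subseteq> {1, -1}"
  by (simp add: one_factor_def)

lemma one_factor_appendD: "one_factor (xs @ ys) \<Longrightarrow> one_factor xs"
  by (induction ys rule: rev_induct) (auto simp: one_factor_snoc simp flip: append_assoc)

lemma Phi1_Nil [simp]: "Phi1 b [] = 0"
  by (simp add: Phi1_def tensor_snoc_yvec)

lemma Phi1_snoc [simp]: "Phi1 b (u @ [a]) = (if a = 1 then b u else 0)"
  by (simp add: Phi1_def tensor_snoc_yvec)

lemma Phi2_Nil [simp]: "Phi2 v i b [] = 0"
  by (simp add: Phi2_def tensor_snoc_yvec)

lemma Phi2_snoc [simp]:
  "Phi2 v i b (u @ [a]) =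
     (if a = -1 then qint v i * b u else if a = 1 then - (v powi i) * F_op v b u else 0)"
  by (simp add: Phi2_def tensor_snoc_yvec)

lemma funpow_F_op_snoc1:
  "(F_op v ^^ k) f (u @ [1]) = inverse v ^ k * (F_op v ^^ k) (\<lambda>w. f (w @ [1])) u"
  by (induction k arbitrary: u) (simp_all add: F_op_snoc1 F_op_scale mult.assoc)

text \<open>
  The powers \<open>F\<^sup>k\<close> acquire the quantum integer \<open>[k]\<close> because \<open>F \<otimes> K\<inverse>\<close> and \<open>1 \<otimes> F\<close> commute up to a
  power of \<open>v\<close> and \<open>(1 \<otimes> F)\<^sup>2 = 0\<close> on the last factor.
\<close>

lemma funpow_F_op_snoc_minus1:
  fixes v :: "'a::field"
  assumes "v \<noteq> 0" "u \<in> words m"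
  shows "(F_op v ^^ Suc k) f (u @ [-1]) =
    v ^ Suc k * (F_op v ^^ Suc k) (\<lambda>w. f (w @ [-1])) u +
    qint v (int k + 1) * (F_op v ^^ k) (\<lambda>w. f (w @ [1])) u"
  using assms(2)
proof (induction k arbitrary: u m)
  case 0
  then show ?case by (simp add: F_op_snoc_minus1)
next
  case (Suc k)
  let ?f1 = "\<lambda>w. f (w @ [1])" and ?f2 = "\<lambda>w. f (w @ [-1])"
  have "(F_op v ^^ Suc (Suc k)) f (u @ [-1]) =
      v * F_op v (\<lambda>w. (F_op v ^^ Suc k) f (w @ [-1])) u + (F_op v ^^ Suc k) f (u @ [1])"
    by (simp only: funpow.simps comp_apply F_op_snoc_minus1[OF Suc.prems])
  also have "F_op v (\<lambda>w. (F_op v ^^ Suc k) f (w @ [-1])) u =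
      F_op v (\<lambda>w. v ^ Suc k * (F_op v ^^ Suc k) ?f2 w + qint v (int k + 1) * (F_op v ^^ k) ?f1 w) u"
    by (intro F_op_cong Suc.IH)
  also have "\<dots> = v ^ Suc k * (F_op v ^^ Suc (Suc k)) ?f2 u
                  + qint v (int k + 1) * (F_op v ^^ Suc k) ?f1 u"
    by (simp only: F_op_linear funpow.simps comp_apply)
  also have "(F_op v ^^ Suc k) f (u @ [1]) = v powi (- int (Suc k)) * (F_op v ^^ Suc k) ?f1 u"
    by (simp only: funpow_F_op_snoc1 power_int_minus power_int_of_nat power_inverse)
  also have "v * (v ^ Suc k * (F_op v ^^ Suc (Suc k)) ?f2 u
        + qint v (int k + 1) * (F_op v ^^ Suc k) ?f1 u)
      + v powi (- int (Suc k)) * (F_op v ^^ Suc k) ?f1 u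
      = v ^ Suc (Suc k) * (F_op v ^^ Suc (Suc k)) ?f2 u
        + (v * qint v (int k + 1) + v powi (- int (Suc k))) * (F_op v ^^ Suc k) ?f1 u"
    by (simp only: power_Suc distrib_left distrib_right mult.assoc add.assoc)
  also have "v * qint v (int k + 1) + v powi (- int (Suc k)) = qint v (int (Suc k) + 1)"
    using qint_add_one(1)[OF assms(1), of "int (Suc k)"] by (simp add: add.commute)
  finally show ?case .
qed

lemma funpow_F_op_scale: "(F_op v ^^ k) (\<lambda>u. c * f u) = (\<lambda>u. c * (F_op v ^^ k) f u)"
  by (induction k; intro ext; simp add: F_op_scale)

lemma funpow_F_op_zero: "(F_op v ^^ k) (\<lambda>u. 0) = (\<lambda>u. 0)"
  by (induction k) simp_all

lemma funpow_F_op_eq_0_if_slices: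
  assumes "\<And>u. (F_op v ^^ Suc k) f (u @ [1]) = 0"
    and "\<And>u. u \<in> words (length u) \<Longrightarrow> (F_op v ^^ Suc k) f (u @ [-1]) = 0"
  shows "(F_op v ^^ Suc k) f = (\<lambda>u. 0)"
proof
  fix u
  show "(F_op v ^^ Suc k) f u = 0"
  proof (cases "u \<in> words (length u)")
    case True
    then show ?thesis
      using assms by (cases u rule: rev_cases) auto
  next
    case False
    then show ?thesis by (simp add: F_op_eq_0)
  qed
qed

text \<open>
  A vector \<open>mu v \<beta>\<close> of weight \<open>s\<close> generates a module of dimension at most \<open>s + 1\<close>.  Appending \<open>y\<^sub>1\<close>
  raises the nilpotency order of \<open>F\<close> by one; the two terms of \<open>Phi2\<close> are balanced so that the order
  drops by one.  The case of interest is \<open>s = 0\<close>, where \<open>F\<close> kills \<open>mu v \<beta>\<close>.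
\<close>

lemma funpow_F_op_mu_eq_0:
  fixes v :: "'a::field"
  assumes "v \<noteq> 0" "one_factor \<beta>"
  shows "(F_op v ^^ Suc (nat (sum_list \<beta>))) (mu v \<beta>) = (\<lambda>u. 0)"
  using assms(2)
proof (induction \<beta> rule: rev_induct)
  case Nil
  have "(F_op v ^^ Suc 0) (yvec []) = (\<lambda>u. 0)"
    by (rule funpow_F_op_eq_0_if_slices) (simp_all add: yvec_def F_op_snoc1 F_op_snoc_minus1)
  then show ?case by (simp add: mu_Nil)
next
  case (snoc a \<beta>)
  let ?b = "mu v \<beta>"
  define s where "s = nat (sum_list \<beta>)"
  have \<beta>: "one_factor \<beta>" and a: "a = 1 \<or> a = -1" "0 \<le> sum_list \<beta> + a"
    using snoc.prems by (auto simp: one_factor_snoc)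
  have s: "sum_list \<beta> = int s" using one_factor_sum_nonneg[OF \<beta>] by (simp add: s_def)
  have IH: "(F_op v ^^ Suc s) ?b = (\<lambda>u. 0)" using snoc.IH[OF \<beta>] by (simp add: s_def)
  have IH': "(F_op v ^^ Suc (Suc s)) ?b = (\<lambda>u. 0)"
    using IH by (simp only: funpow.simps(2)[of "Suc s"] comp_apply F_op_zero)
  show ?case
  proof (cases "a = 1")
    case True
    have sum: "nat (sum_list (\<beta> @ [a])) = Suc s" using True s by simp
    have slices: "(\<lambda>w. Phi1 ?b (w @ [1])) = ?b" "(\<lambda>w. Phi1 ?b (w @ [-1])) = (\<lambda>w. 0)" by auto
    have "(F_op v ^^ Suc (Suc s)) (Phi1 ?b) (u @ [1]) = 0" for u
      by (simp only: funpow_F_op_snoc1 slices IH') simp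
    moreover have "(F_op v ^^ Suc (Suc s)) (Phi1 ?b) (u @ [-1]) = 0" if u: "u \<in> words (length u)" for u
      by (simp only: funpow_F_op_snoc_minus1[OF assms(1) u] slices IH funpow_F_op_zero) simp
    ultimately have "(F_op v ^^ Suc (Suc s)) (Phi1 ?b) = (\<lambda>u. 0)"
      by (rule funpow_F_op_eq_0_if_slices)
    then show ?thesis
      unfolding sum using True by (simp add: mu_snoc del: funpow.simps)
  next
    case False
    then have a: "a = -1" and "s \<noteq> 0" using a s by auto
    then obtain k where k: "s = Suc k" by (cases s) auto
    have sum: "nat (sum_list (\<beta> @ [a])) = k" using a s k by simp
    let ?g = "Phi2 v (int s) ?b"
    have slices: "(\<lambda>w. ?g (w @ [1])) = (\<lambda>w. - (v ^ s) * F_op v ?b w)"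
      "(\<lambda>w. ?g (w @ [-1])) = (\<lambda>w. qint v (int s) * ?b w)" by auto
    have F: "(F_op v ^^ j) (F_op v ?b) u = (F_op v ^^ Suc j) ?b u" for j u
      by (simp only: funpow_Suc_right comp_apply)
    have "(F_op v ^^ Suc k) ?g (u @ [1]) = 0" for u
      by (simp only: funpow_F_op_snoc1 slices funpow_F_op_scale F IH[unfolded k]) simp
    moreover have "(F_op v ^^ Suc k) ?g (u @ [-1]) = 0" if u: "u \<in> words (length u)" for u
      by (simp only: funpow_F_op_snoc_minus1[OF assms(1) u] slices funpow_F_op_scale F)
        (simp only: k of_nat_Suc add.commute[of 1] mult.assoc minus_mult_left mult.left_commute[of "v ^ Suc k"], simp)
    ultimately have "(F_op v ^^ Suc k) ?g = (\<lambda>u. 0)"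
      by (rule funpow_F_op_eq_0_if_slices)
    then show ?thesis
      unfolding sum using a s by (simp add: mu_snoc del: funpow.simps)
  qed
qed

text \<open>
  When the partial sums first become negative, \<open>Phi2\<close> is applied in weight \<open>0\<close>.  Its first term
  carries the factor \<open>[0] = 0\<close> and its second one is \<open>F\<close> of a vector killed by \<open>F\<close>.  Hence sums over
  1-factors may be extended to all words of the given weight, which frees the later reindexing of
  sums from positivity conditions.
\<close>

lemma mu_eq_0_if_not_one_factor:
  fixes v :: "'a::field"
  assumes "v \<noteq> 0" "set \<beta> \<subseteq> {1, -1}" "\<not> one_factor \<beta>"
  shows "mu v \<beta> = (\<lambda>u. 0)"
  using assms(2,3)
proof (induction \<beta> rule: rev_induct)
  case (snoc a \<beta>)
  have ext: "f = (\<lambda>u. 0)" if "f [] = 0" "\<And>u c. f (u @ [c]) = 0" for f :: "int list \<Rightarrow> 'a"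
    using that by (metis rev_exhaust)
  show ?case
  proof (cases "one_factor \<beta>")
    case True
    then have "sum_list \<beta> = 0" "a = -1"
      using snoc.prems one_factor_sum_nonneg[OF True] by (auto simp: one_factor_snoc)
    then show ?thesis
      using funpow_F_op_mu_eq_0[OF assms(1) True] by (auto simp: mu_snoc intro!: ext)
  next
    case False
    then have "mu v \<beta> = (\<lambda>u. 0)" using snoc by auto
    then show ?thesis by (auto simp: mu_snoc intro!: ext)
  qed
qed simp

section \<open>Insertion of a cup\<close>

text \<open>
  The coefficient of \<open>y\<^sub>a \<otimes> y\<^sub>b\<close> in the cup \<open>y\<^sub>1 \<otimes> y\<^sub>-\<^sub>1 - v y\<^sub>-\<^sub>1 \<otimes> y\<^sub>1\<close>, the link that
  joins two neighbouring positions.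
\<close>

definition cup :: "'a::field \<Rightarrow> int \<Rightarrow> int \<Rightarrow> 'a" where
  "cup v a b = (if a = 1 \<and> b = -1 then 1 else if a = -1 \<and> b = 1 then - v else 0)"

text \<open>
  The map \<open>1\<^bsup>\<otimes>p\<^esup> \<otimes> \<cup> \<otimes> 1\<^bsup>\<otimes>(m-p)\<^esup>\<close> from the \<open>m\<close>-th to the \<open>(m+2)\<close>-nd tensor power that puts a cup
  behind the first \<open>p\<close> factors.
\<close>

definition insert_cup :: "'a::field \<Rightarrow> nat \<Rightarrow> (int list \<Rightarrow> 'a) \<Rightarrow> int list \<Rightarrow> 'a" where
  "insert_cup v p f u =
     (if p + 2 \<le> length u then cup v (u ! p) (u ! (p + 1)) * f (take p u @ drop (p + 2) u) else 0)"

lemma insert_cup_append: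
  "length x = p \<Longrightarrow> insert_cup v p f (x @ [a, b] @ y) = cup v a b * f (x @ y)"
  by (simp add: insert_cup_def nth_append)

lemma insert_cup_snoc:
  "p + 2 \<le> length u \<Longrightarrow> insert_cup v p f (u @ [a]) = insert_cup v p (\<lambda>w. f (w @ [a])) u"
  by (simp add: insert_cup_def nth_append)

lemma insert_cup_short: "length u < p + 2 \<Longrightarrow> insert_cup v p f u = 0"
  by (simp add: insert_cup_def)

lemma insert_cup_linear:
  "insert_cup v p (\<lambda>u. c * f u + d * g u) u = c * insert_cup v p f u + d * insert_cup v p g u"
  by (simp add: insert_cup_def algebra_simps)

lemma insert_cup_sum:
  "insert_cup v p (\<lambda>w. \<Sum>x\<in>A. c x * f x w) u = (\<Sum>x\<in>A. c x * insert_cup v p (f x) u)"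
  by (simp add: insert_cup_def sum_distrib_left mult.left_commute)

lemma insert_cup_eq_0_if_not_word:
  assumes "\<And>w. w \<notin> words (length w) \<Longrightarrow> f w = 0" "u \<notin> words (length u)"
  shows "insert_cup v p f u = 0"
proof (cases "p + 2 \<le> length u \<and> cup v (u ! p) (u ! (p + 1)) \<noteq> 0")
  case True
  have u: "u = take p u @ [u ! p, u ! (p + 1)] @ drop (p + 2) u"
    using True by (simp add: Cons_nth_drop_Suc)
  have "set [u ! p, u ! (p + 1)] \<subseteq> {1, -1}"
    using True by (auto simp: cup_def split: if_splits)
  moreover have "\<not> set u \<subseteq> {1, -1}" using assms(2) by (simp add: words_def)
  ultimately have "\<not> set (take p u @ drop (p + 2) u) \<subseteq> {1, -1}"
    using arg_cong[OF u, of set] by auto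
  then show ?thesis using assms(1) by (auto simp: insert_cup_def words_def)
qed (auto simp: insert_cup_def)

text \<open>
  The cup is invariant: \<open>F\<close> kills it and \<open>K\<close> fixes it.  Stripping factors from the right reduces
  the claim to a cup in the last two positions, where it is a computation with four cases.
\<close>

lemma F_op_insert_cup:
  assumes "v \<noteq> 0"
  shows "F_op v (insert_cup v p f) u = insert_cup v p (F_op v f) u"
proof (induction u arbitrary: f rule: rev_induct)
  case Nil
  show ?case by (simp add: insert_cup_short)
next
  case (snoc b u)
  show ?case
  proof (cases "u @ [b] \<in> words (length (u @ [b]))")
    case False
    then show ?thesis by (simp add: F_op_eq_0 insert_cup_eq_0_if_not_word)
  next
    case True
    then have u: "u \<in> words (length u)" and b: "b = 1 \<or> b = -1" by auto
    consider "p + 2 \<le> length u" | "p + 2 = length (u @ [b])" | "length (u @ [b]) < p + 2"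
      by fastforce
    then show ?thesis
    proof cases
      case 1
      have "F_op v (\<lambda>w. insert_cup v p f (w @ [b])) u = F_op v (insert_cup v p (\<lambda>w. f (w @ [b]))) u"
        using 1 by (intro F_op_cong) (simp add: insert_cup_snoc length_words)
      then have "F_op v (insert_cup v p f) (u @ [b]) =
          v powi (- b) * F_op v (insert_cup v p (\<lambda>w. f (w @ [b]))) u
           + (if b = -1 then 1 else 0) * insert_cup v p (\<lambda>w. f (w @ [1])) u"
        using 1 by (simp add: F_op_snoc_word[OF u b] insert_cup_snoc)
      also have "\<dots> = insert_cup v p (\<lambda>w. v powi (- b) * F_op v (\<lambda>w. f (w @ [b])) w
           + (if b = -1 then 1 else 0) * f (w @ [1])) u"
        by (simp only: insert_cup_linear snoc.IH)
      also have "\<dots> = insert_cup v p (\<lambda>w. F_op v f (w @ [b])) u"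
      proof -
        let ?w = "take p u @ drop (p + 2) u"
        have "set ?w \<subseteq> set u" using set_take_subset set_drop_subset by fastforce
        then have "?w \<in> words (length ?w)" using u by (auto simp: words_def)
        then have "F_op v f (?w @ [b]) = v powi (- b) * F_op v (\<lambda>w. f (w @ [b])) ?w
            + (if b = -1 then 1 else 0) * f (?w @ [1])"
          using F_op_snoc_word[of ?w "length ?w" b v f] b by auto
        then show ?thesis
          using 1 by (simp add: insert_cup_def)
      qed
      finally show ?thesis using 1 by (simp add: insert_cup_snoc)
    next
      case 2
      then obtain w a where w: "u = w @ [a]" "length w = p"
        by (cases u rule: rev_cases) auto
      have ww: "w \<in> words (length w)" and a: "a = 1 \<or> a = -1" using u w by auto
      have app: "insert_cup v p f ((x @ [c]) @ [d]) = cup v c d * f x" if "length x = p" for f x c d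
        using insert_cup_append[OF that, of v f c d "[]"] by simp
      have F2: "F_op v (\<lambda>x. insert_cup v p f ((x @ [c]) @ [d])) w = cup v c d * F_op v f w" for c d
      proof -
        have "F_op v (\<lambda>x. insert_cup v p f ((x @ [c]) @ [d])) w = F_op v (\<lambda>x. cup v c d * f x) w"
          using w(2) by (intro F_op_cong app) (simp add: length_words)
        then show ?thesis by (simp add: F_op_scale)
      qed
      have "F_op v (insert_cup v p f) ((w @ [a]) @ [b]) = cup v a b * F_op v f w"
        using u a b assms F2 app[OF w(2)] unfolding w
        by (auto simp: F_op_snoc_word[OF u[unfolded w]] F_op_snoc_word[OF ww] cup_def
            simp del: append_assoc)
      moreover have "insert_cup v p (F_op v f) (w @ [a, b]) = cup v a b * F_op v f w"
        using insert_cup_append[OF w(2), of v "F_op v f" a b "[]"] by simp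
      ultimately show ?thesis by (simp add: w)
    next
      case 3
      then have "F_op v (insert_cup v p f) (u @ [b]) = F_op v (\<lambda>w. 0) (u @ [b])"
        by (intro F_op_cong) (simp add: insert_cup_short length_words)
      then show ?thesis using 3 by (simp add: insert_cup_short)
    qed
  qed
qed

lemma tensor_power_eq_0: "f \<in> tensor_power m \<Longrightarrow> length u \<noteq> m \<Longrightarrow> f u = 0"
  by (auto simp: tensor_power_def words_def)

text \<open>
  Vectors of too small a degree must be excluded here: on them the left-hand side can place the cup
  behind the factor that \<open>Phi1\<close> appends.  The same holds for \<open>Phi2\<close>.
\<close>

lemma insert_cup_Phi1:
  assumes "f \<in> tensor_power m" "p \<le> m"
  shows "insert_cup v p (Phi1 f) = Phi1 (insert_cup v p f)"
proof
  fix u show "insert_cup v p (Phi1 f) u = Phi1 (insert_cup v p f) u"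
  proof (cases u rule: rev_cases)
    case (snoc w a)
    have "Phi1 f x = 0" if "length x = p" for x
      using that assms tensor_power_eq_0[OF assms(1)] by (cases x rule: rev_cases) auto
    then show ?thesis
      by (cases "p + 2 \<le> length w")
         (auto simp: snoc insert_cup_snoc insert_cup_short, auto simp: insert_cup_def)
  qed (simp add: insert_cup_short)
qed

lemma F_op_tensor_power:
  assumes "f \<in> tensor_power m" shows "F_op v f \<in> tensor_power m"
proof -
  have "F_op v f u = 0" if "u \<notin> words m" for u
  proof (rule ccontr)
    assume "F_op v f u \<noteq> 0"
    then obtain w where "f w \<noteq> 0" "u \<in> words (length u)" "w \<in> words (length u)"
      by (rule F_op_nonzero)
    moreover from this assms have "length w = m" by (metis (mono_tags, lifting) length_words mem_Collect_eq tensor_power_def)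
    ultimately show False using that by (auto simp: words_def)
  qed
  then show ?thesis by (simp add: tensor_power_def)
qed

lemma insert_cup_Phi2:
  assumes "v \<noteq> 0" "f \<in> tensor_power m" "p \<le> m"
  shows "insert_cup v p (Phi2 v s f) = Phi2 v s (insert_cup v p f)"
proof
  fix u show "insert_cup v p (Phi2 v s f) u = Phi2 v s (insert_cup v p f) u"
  proof (cases u rule: rev_cases)
    case (snoc w a)
    have z: "Phi2 v s f x = 0" if "length x = p" for x
      using that assms tensor_power_eq_0[OF assms(2)] tensor_power_eq_0[OF F_op_tensor_power[OF assms(2)]]
      by (cases x rule: rev_cases) auto
    then show ?thesis
      by (cases "p + 2 \<le> length w")
         (auto simp: snoc insert_cup_snoc F_op_insert_cup[OF assms(1)], auto simp: insert_cup_def)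
  qed (simp add: insert_cup_short)
qed

text \<open>
  The relation that produces all transition coefficients.  With a cup at the right end it compares
  \<open>Phi2\<close> after \<open>Phi1\<close> with \<open>Phi1\<close> after \<open>Phi2\<close>: the terms containing \<open>F\<close> cancel, and
  \<open>v\<^bsup>s+1\<^esup> + [s] = v [s+1]\<close> leaves \<open>[s+1]\<close> times a cup.  Everything appended further to the right
  commutes with the insertion and sees the same weights on both sides.
\<close>

lemma insert_cup_mu:
  fixes v :: "'a::field"
  assumes "v \<noteq> 0" "set \<beta>' \<subseteq> {1, -1}" "set \<beta>'' \<subseteq> {1, -1}"
  shows "qint v (sum_list \<beta>' + 1) * insert_cup v (length \<beta>') (mu v (\<beta>' @ \<beta>'')) u =
    mu v (\<beta>' @ [1, -1] @ \<beta>'') u - mu v (\<beta>' @ [-1, 1] @ \<beta>'') u"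
  using assms(3)
proof (induction \<beta>'' arbitrary: u rule: rev_induct)
  case Nil
  define b s where "b = mu v \<beta>'" and "s = sum_list \<beta>'"
  have b: "b \<in> tensor_power (length \<beta>')"
    using mu_homogeneous[OF assms(2), of v] by (simp add: b_def)
  have mu: "mu v (\<beta>' @ [1, -1]) = Phi2 v (s + 1) (Phi1 b)"
    "mu v (\<beta>' @ [-1, 1]) = Phi1 (Phi2 v s b)"
    using mu_snoc[of v "\<beta>' @ [1]" "-1"] mu_snoc[of v "\<beta>' @ [-1]" 1]
    by (simp_all add: mu_snoc b_def s_def)
  have "qint v (s + 1) * insert_cup v (length \<beta>') b u = Phi2 v (s + 1) (Phi1 b) u - Phi1 (Phi2 v s b) u"
  proof -
    consider "u = []" | a where "u = [a]" | w a c where "u = (w @ [a]) @ [c]"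
      by (metis append_Nil rev_exhaust)
    then show ?thesis
    proof cases
      case 1
      then show ?thesis by (simp add: insert_cup_short)
    next
      case 2
      have "Phi2 v i f [c] = (if c = -1 then qint v i * f [] else 0)" "Phi1 f [c] = (if c = 1 then f [] else 0)"
         for f i c using Phi2_snoc[of v i f "[]" c] Phi1_snoc[of f "[]" c] by auto
      then show ?thesis using 2 by (simp add: insert_cup_short)
    next
      case 3
      have ins: "insert_cup v (length \<beta>') b u = cup v a c * b w"
      proof (cases "length w = length \<beta>'")
        case True
        then show ?thesis using insert_cup_append[OF True, of v b a c "[]"] 3 by simp
      next
        case False
        then show ?thesis using 3 b by (auto simp: insert_cup_def tensor_power_eq_0)
      qed
      have q: "v * qint v (s + 1) = v powi (s + 1) + qint v s"
        using qint_add_one(2)[OF assms(1), of s] powi_shift(1)[OF assms(1), of s] assms(1)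
        by (simp add: algebra_simps)
      have F: "F_op v (Phi1 b) (w @ [-1]) = b w"
      proof (cases "w \<in> words (length w)")
        case True
        then show ?thesis by (simp add: F_op_snoc_minus1)
      next
        case False
        then have "b w = 0" using b by (auto simp: tensor_power_def words_def)
        then show ?thesis using False F_op_eq_0[of "w @ [-1]"] by simp
      qed
      have F0: "F_op v (Phi1 b) (w @ [a]) = 0" if "a \<noteq> 1" "a \<noteq> -1"
        using that by (intro F_op_eq_0) (simp add: words_def)
      have Phi1': "(\<lambda>u. Phi1 b (u @ [1])) = b" by auto
      show ?thesis
        unfolding ins unfolding 3 Phi2_snoc Phi1_snoc
        using F F0 q powi_shift(1)[OF assms(1), of s] assms(1)
        by (auto simp: cup_def F_op_snoc1 Phi1' algebra_simps)
    qed
  qed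
  then show ?case using mu by (simp add: b_def s_def)
next
  case (snoc a \<beta>'')
  let ?p = "length \<beta>'" and ?k = "qint v (sum_list \<beta>' + 1)" and ?b = "mu v (\<beta>' @ \<beta>'')"
  let ?s = "sum_list (\<beta>' @ \<beta>'')"
  have a: "a = 1 \<or> a = -1" and set: "set \<beta>'' \<subseteq> {1, -1}" using snoc.prems by auto
  have b: "?b \<in> tensor_power (length (\<beta>' @ \<beta>''))"
    using mu_homogeneous[of "\<beta>' @ \<beta>''" v] assms(2) set by simp
  note IH = snoc.IH[OF set]
  have IHF: "?k * F_op v (insert_cup v ?p ?b) w =
      F_op v (mu v (\<beta>' @ [1, -1] @ \<beta>'')) w - F_op v (mu v (\<beta>' @ [-1, 1] @ \<beta>'')) w" for w
    using IH F_op_scale[of v ?k "insert_cup v ?p ?b" w]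
      F_op_linear[of v 1 "mu v (\<beta>' @ [1, -1] @ \<beta>'')" "-1" "mu v (\<beta>' @ [-1, 1] @ \<beta>'')" w]
    by simp
  have mu: "mu v (\<beta>' @ x @ \<beta>'' @ [a]) =
      (if a = 1 then Phi1 (mu v (\<beta>' @ x @ \<beta>'')) else Phi2 v (sum_list (\<beta>' @ x @ \<beta>'')) (mu v (\<beta>' @ x @ \<beta>'')))" for x
    using mu_snoc[of v "\<beta>' @ x @ \<beta>''" a] by simp
  have "?k * insert_cup v ?p (mu v (\<beta>' @ \<beta>'' @ [a])) u =
    ?k * (if a = 1 then Phi1 (insert_cup v ?p ?b) else Phi2 v ?s (insert_cup v ?p ?b)) u"
    using insert_cup_Phi1[OF b, of ?p v] insert_cup_Phi2[OF assms(1) b, of ?p ?s] mu[of "[]"] by simp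
  also have "\<dots> = mu v (\<beta>' @ [1, -1] @ \<beta>'' @ [a]) u - mu v (\<beta>' @ [-1, 1] @ \<beta>'' @ [a]) u"
  proof (cases u rule: rev_cases)
    case (snoc w c)
    have IH': "mu v (\<beta>' @ [1, -1] @ \<beta>'') w = ?k * insert_cup v ?p ?b w + mu v (\<beta>' @ [-1, 1] @ \<beta>'') w"
      "F_op v (mu v (\<beta>' @ [1, -1] @ \<beta>'')) w =
        ?k * F_op v (insert_cup v ?p ?b) w + F_op v (mu v (\<beta>' @ [-1, 1] @ \<beta>'')) w"
      using IH[of w] IHF[of w] by (simp_all add: algebra_simps)
    show ?thesis
      unfolding mu snoc by (auto simp add: IH'[simplified] algebra_simps)
  next
    case Nil
    show ?thesis unfolding mu Nil by simp
  qed
  finally show ?case .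
qed

section \<open>Nesting of pairings and the vectors \<open>eta\<close>\<close>

abbreviation height :: "int list \<Rightarrow> nat \<Rightarrow> int" where
  "height \<alpha> k \<equiv> sum_list (take k \<alpha>)"

lemma height_Suc: "k < length \<alpha> \<Longrightarrow> height \<alpha> (Suc k) = height \<alpha> k + \<alpha> ! k"
  by (simp add: take_Suc_conv_app_nth)

lemma sum_nth_eq_height:
  "j < length \<alpha> \<Longrightarrow> i \<le> j \<Longrightarrow> (\<Sum>k=i..j. \<alpha> ! k) = height \<alpha> (Suc j) - height \<alpha> i"
proof (induction j)
  case 0
  then show ?case by (simp add: height_Suc)
next
  case (Suc j)
  then show ?case by (cases "i = Suc j") (auto simp: height_Suc)
qed

text \<open>
  The partial sums move in steps of size one, so a path that leaves a level upwards and has not yet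
  returned to it stays strictly above it.
\<close>

lemma mem_pairings_iff:
  assumes "set \<alpha> \<subseteq> {1, -1}"
  shows "(i, j) \<in> pairings \<alpha> \<longleftrightarrow>
    i < j \<and> j < length \<alpha> \<and> \<alpha> ! i = 1 \<and> height \<alpha> (Suc j) = height \<alpha> i \<and>
    (\<forall>k. i < k \<and> k \<le> j \<longrightarrow> height \<alpha> i < height \<alpha> k)" (is "_ \<longleftrightarrow> ?rhs")
proof
  assume ij: "(i, j) \<in> pairings \<alpha>"
  then have j: "i < j" "j < length \<alpha>" "\<alpha> ! i = 1" by (auto simp: pairings_def)
  have ne: "height \<alpha> (Suc k) \<noteq> height \<alpha> i" if "i < k" "k < j" for k
    using ij that sum_nth_eq_height[of k \<alpha> i] by (auto simp: pairings_def)
  have "height \<alpha> i < height \<alpha> k" if "i < k" "k \<le> j" for k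
    using that
  proof (induction k)
    case (Suc k)
    show ?case
    proof (cases "k = i")
      case True
      then show ?thesis using j by (simp add: height_Suc)
    next
      case False
      then have IH: "height \<alpha> i < height \<alpha> k" and k: "i < k" "k < j" using Suc by auto
      have "\<alpha> ! k \<in> set \<alpha>" using k j by simp
      then have "\<alpha> ! k \<ge> -1" using assms by auto
      then show ?thesis using IH ne[OF k] k j by (simp add: height_Suc)
    qed
  qed simp
  then show ?rhs using ij j sum_nth_eq_height[of j \<alpha> i] by (auto simp: pairings_def)
next
  assume r: ?rhs
  then have "(\<Sum>k=i..j'. \<alpha> ! k) \<noteq> 0" if "i < j'" "j' < j" for j'
    using that sum_nth_eq_height[of j' \<alpha> i] by (auto dest!: spec[of _ "Suc j'"])
  then show "(i, j) \<in> pairings \<alpha>" using r sum_nth_eq_height[of j \<alpha> i] by (auto simp: pairings_def)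
qed

lemma one_factor_iff:
  "one_factor \<alpha> \<longleftrightarrow> set \<alpha> \<subseteq> {1, -1} \<and> (\<forall>k. 0 \<le> height \<alpha> k)"
  unfolding one_factor_def by (metis linear order_refl take_all)

lemma pairing_of_first:
  assumes "one_factor x" "sum_list x = 0" "set y \<subseteq> {1, -1}"
  shows "(0, j) \<in> pairings (1 # x @ (-1) # y) \<longleftrightarrow> j = Suc (length x)"
proof -
  let ?\<alpha> = "1 # x @ (-1) # y"
  have h: "0 < height ?\<alpha> k" if "0 < k" "k \<le> Suc (length x)" for k
  proof -
    have "height ?\<alpha> k = 1 + height x (k - 1)" using that by (cases k) auto
    then show ?thesis using assms(1) by (simp add: one_factor_iff add_pos_nonneg)
  qed
  have h0: "height ?\<alpha> (Suc (Suc (length x))) = 0" using assms(2) by simp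
  have set: "set ?\<alpha> \<subseteq> {1, -1}" using assms by (auto simp: one_factor_iff)
  show ?thesis
    unfolding mem_pairings_iff[OF set]
  proof (intro iffI conjI)
    assume r: "0 < j \<and> j < length ?\<alpha> \<and> ?\<alpha> ! 0 = 1 \<and> height ?\<alpha> (Suc j) = height ?\<alpha> 0 \<and>
      (\<forall>k. 0 < k \<and> k \<le> j \<longrightarrow> height ?\<alpha> 0 < height ?\<alpha> k)"
    then have "\<not> Suc j \<le> Suc (length x)" using h[of "Suc j"] by auto
    moreover have "\<not> Suc (Suc (length x)) \<le> j" using r h0 by force
    ultimately show "j = Suc (length x)" by simp
  qed (use h h0 in \<open>auto\<close>)
qed

lemma first_unpaired:
  assumes "one_factor z"
  shows "(0, j) \<notin> pairings (1 # z)"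
proof
  assume "(0, j) \<in> pairings (1 # z)"
  moreover have "set (1 # z) \<subseteq> {1, -1}" using assms by (auto simp: one_factor_iff)
  ultimately have "height (1 # z) (Suc j) = 0" by (simp add: mem_pairings_iff)
  moreover have "0 \<le> height z j" using assms by (simp add: one_factor_iff)
  ultimately show False by simp
qed

lemma eta_link:
  assumes "one_factor x" "sum_list x = 0" "set y \<subseteq> {1, -1}"
  shows "eta v (1 # x @ (-1) # y) = Psi v (eta v x) \<otimes>\<^sub>V eta v y"
  by (simp add: pairing_of_first[OF assms])

lemma eta_defect:
  assumes "one_factor z"
  shows "eta v (1 # z) = yvec [1] \<otimes>\<^sub>V eta v z"
  by (simp add: first_unpaired[OF assms])

text \<open>
  The first-return decomposition of a Dyck path: it decides whether the up-step placed in front of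
  \<open>z\<close> is paired, and with what.
\<close>

lemma first_return:
  assumes "set z \<subseteq> {1, -1}" "\<not> one_factor z"
  obtains x y where "z = x @ (-1) # y" "one_factor x" "sum_list x = 0"
  using assms
proof (induction z arbitrary: thesis rule: rev_induct)
  case (snoc a z)
  show ?case
  proof (cases "one_factor z")
    case True
    then have "sum_list z = 0" "a = -1"
      using snoc.prems one_factor_sum_nonneg[OF True] by (auto simp: one_factor_snoc)
    then show ?thesis using True snoc.prems(1)[of z "[]"] by simp
  next
    case False
    then obtain x y where "z = x @ (-1) # y" "one_factor x" "sum_list x = 0"
      using snoc.IH snoc.prems by auto
    then show ?thesis using snoc.prems(1)[of x "y @ [a]"] by simp
  qed
qed simp

lemma tensor_eq:
  assumes "f \<in> tensor_power m"
  shows "(f \<otimes>\<^sub>V g) u = (if m \<le> length u then f (take m u) * g (drop m u) else 0)"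
proof -
  have "(f \<otimes>\<^sub>V g) u = (\<Sum>k\<le>length u. if k = m then f (take m u) * g (drop m u) else 0)"
    unfolding tensor_def using tensor_power_eq_0[OF assms] by (intro sum.cong refl) auto
  then show ?thesis by simp
qed

lemma append_in_words: "x \<in> words m \<Longrightarrow> y \<in> words k \<Longrightarrow> x @ y \<in> words (m + k)"
  by (auto simp: words_def)

lemma take_drop_in_words:
  "take m u \<in> words m \<Longrightarrow> drop m u \<in> words k \<Longrightarrow> u \<in> words (m + k)"
  using append_in_words[of "take m u" m "drop m u" k] by simp

lemma tensor_in_tensor_power:
  assumes "f \<in> tensor_power m" "g \<in> tensor_power k"
  shows "f \<otimes>\<^sub>V g \<in> tensor_power (m + k)"
  using assms take_drop_in_words[of m _ k]
  by (auto simp: tensor_power_def tensor_eq[OF assms(1)])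

lemma yvec_in_tensor_power: "w \<in> words m \<Longrightarrow> yvec w \<in> tensor_power m"
  by (auto simp: tensor_power_def yvec_def)

lemma yvec_tensor_Nil [simp]: "(yvec [a] \<otimes>\<^sub>V g) [] = 0"
  by (simp add: tensor_def yvec_def)

lemma yvec_tensor_Cons [simp]: "(yvec [a] \<otimes>\<^sub>V g) (c # w) = (if c = a then g w else 0)"
proof -
  have "(yvec [a] \<otimes>\<^sub>V g) (c # w) = (\<Sum>k\<le>Suc (length w). if k = 1 then (if c = a then g w else 0) else 0)"
    unfolding tensor_def
  proof (intro sum.cong)
    fix k
    show "yvec [a] (take k (c # w)) * g (drop k (c # w)) = (if k = 1 then (if c = a then g w else 0) else 0)"
      if "k \<in> {..Suc (length w)}"
      using that by (cases k; cases "k - 1"; cases w) (auto simp: yvec_def)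
  qed simp
  also have "\<dots> = (if c = a then g w else 0)" by (simp only: sum.delta finite_atMost) simp
  finally show ?thesis .
qed

lemma Psi_eq: "Psi v b (a # w @ [c]) = cup v a c * b w"
  by (simp add: Psi_def cup_def tensor_snoc_yvec)

lemma Psi_short: "length u < 2 \<Longrightarrow> Psi v b u = 0"
  by (cases u) (auto simp: Psi_def tensor_snoc_yvec)

lemma list_cases_both_ends:
  obtains "length u < 2" | a w c where "u = a # w @ [c]"
proof (cases u)
  case (Cons a u')
  then show ?thesis using that by (cases u' rule: rev_cases) auto
qed (use that in auto)

lemma Psi_in_tensor_power:
  assumes "b \<in> tensor_power m"
  shows "Psi v b \<in> tensor_power (Suc (Suc m))"
proof -
  have "Psi v b u = 0" if "u \<notin> words (Suc (Suc m))" for u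
    using that assms
    by (cases u rule: list_cases_both_ends)
      (auto simp: Psi_short Psi_eq cup_def tensor_power_def words_def)
  then show ?thesis by (simp add: tensor_power_def)
qed

lemma eta_in_tensor_power: "eta v \<alpha> \<in> tensor_power (length \<alpha>)"
proof (induction v \<alpha> rule: eta.induct)
  case (1 v)
  show ?case by (simp add: yvec_in_tensor_power)
next
  case (2 v a as)
  show ?case
  proof (cases "\<exists>j. (0, j) \<in> pairings (a # as)")
    case True
    then obtain j where j: "(0, j) \<in> pairings (a # as)" ..
    have the: "(THE j. (0, j) \<in> pairings (a # as)) = j"
      using j by (intro the_equality) (auto simp: pairings_def, metis linorder_neqE_nat)
    have "0 < j" "j \<le> length as" using j by (auto simp: pairings_def)
    then have "Suc (Suc (j - 1)) + (length as - j) = length (a # as)"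
      "length (take (j - 1) as) = j - 1" by auto
    moreover have "Psi v (eta v (take (j - 1) as)) \<otimes>\<^sub>V eta v (drop j as) \<in>
        tensor_power (Suc (Suc (length (take (j - 1) as))) + length (drop j as))"
      using 2(1,2)[OF True, of j] the by (intro tensor_in_tensor_power Psi_in_tensor_power) auto
    ultimately show ?thesis using True the by simp
  next
    case False
    then have "yvec [1] \<otimes>\<^sub>V eta v as \<in> tensor_power (1 + length as)"
      using 2(3) by (intro tensor_in_tensor_power yvec_in_tensor_power) (auto simp: words_def)
    then show ?thesis using False by simp
  qed
qed

lemma insert_cup_Cons:
  "insert_cup v (Suc p) g (a # w) = insert_cup v p (\<lambda>x. g (a # x)) w"
  by (simp add: insert_cup_def)

lemma insert_cup_yvec_tensor:
  "insert_cup v (Suc p) (yvec [1] \<otimes>\<^sub>V f) = yvec [1] \<otimes>\<^sub>V insert_cup v p f"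
proof
  fix u show "insert_cup v (Suc p) (yvec [1] \<otimes>\<^sub>V f) u = (yvec [1] \<otimes>\<^sub>V insert_cup v p f) u"
    by (cases u) (simp_all add: insert_cup_short insert_cup_Cons, simp add: insert_cup_def)
qed

lemma insert_cup_in_tensor_power:
  assumes "f \<in> tensor_power m"
  shows "insert_cup v p f \<in> tensor_power (Suc (Suc m))"
proof -
  have "insert_cup v p f u = 0" if u: "u \<notin> words (Suc (Suc m))" for u
  proof (cases "length u = m + 2")
    case True
    then show ?thesis using u assms
      by (intro insert_cup_eq_0_if_not_word) (auto simp: tensor_power_def words_def)
  next
    case False
    then show ?thesis by (auto simp: insert_cup_def tensor_power_eq_0[OF assms])
  qed
  then show ?thesis by (simp add: tensor_power_def)
qed

lemma insert_cup_Psi: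
  assumes "f \<in> tensor_power m" "p \<le> m"
  shows "insert_cup v (Suc p) (Psi v f) = Psi v (insert_cup v p f)"
proof
  fix u show "insert_cup v (Suc p) (Psi v f) u = Psi v (insert_cup v p f) u"
  proof (cases u rule: list_cases_both_ends)
    case 1
    then show ?thesis by (simp add: insert_cup_short Psi_short)
  next
    case (2 a w c)
    show ?thesis
    proof (cases "p + 2 \<le> length w")
      case True
      then show ?thesis
        by (simp add: 2 insert_cup_Cons insert_cup_snoc Psi_eq) (simp add: insert_cup_def)
    next
      case False
      then show ?thesis
        using assms(2)
        by (auto simp: 2 Psi_eq insert_cup_short insert_cup_def[of v "Suc p"]
            tensor_power_eq_0[OF Psi_in_tensor_power[OF assms(1)]])
    qed
  qed
qed

lemma insert_cup_tensor:
  assumes "f \<in> tensor_power m" "p \<le> m"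
  shows "insert_cup v p (f \<otimes>\<^sub>V g) = insert_cup v p f \<otimes>\<^sub>V g"
proof
  fix u
  show "insert_cup v p (f \<otimes>\<^sub>V g) u = (insert_cup v p f \<otimes>\<^sub>V g) u"
  proof (cases "m + 2 \<le> length u")
    case True
    then have "m \<le> length u - 2" by simp
    then show ?thesis
      using assms(2) True
      by (simp add: tensor_eq[OF assms(1)] tensor_eq[OF insert_cup_in_tensor_power[OF assms(1)]]
          insert_cup_def min_def drop_take)
  next
    case False
    then show ?thesis
      by (auto simp: tensor_eq[OF assms(1)] tensor_eq[OF insert_cup_in_tensor_power[OF assms(1)]]
          insert_cup_def)
  qed
qed

lemma one_factor_insert_iff:
  "one_factor (x @ [1, -1] @ y) \<longleftrightarrow> one_factor (x @ y)"
proof (induction y rule: rev_induct)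
  case Nil
  show ?case
    using one_factor_snoc[of "x @ [1]" "-1"] one_factor_sum_nonneg[of x]
    by (auto simp: one_factor_snoc)
next
  case (snoc a y)
  then show ?case
    using one_factor_snoc[of "x @ [1, -1] @ y" a] one_factor_snoc[of "x @ y" a] by simp
qed

text \<open>
  Only pairings of neighbours that follow a run of entries \<open>1\<close> are treated, because every 1-factor
  with a pairing has one of these.  When the run is not empty, this leaves two cases in the recursion
  for \<open>eta\<close>: the first entry is a defect, or it is paired and the inserted pair lies inside its link.
\<close>

lemma eta_insert:
  assumes "one_factor (replicate k 1 @ \<alpha>)"
  shows "eta v (replicate k 1 @ [1, -1] @ \<alpha>) = insert_cup v k (eta v (replicate k 1 @ \<alpha>))"
  using assms
proof (induction k arbitrary: \<alpha>)
  case 0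
  have cup: "Psi v (yvec []) \<in> tensor_power 2"
    using Psi_in_tensor_power[OF yvec_in_tensor_power[of "[]" 0]] by (simp add: numeral_2_eq_2)
  have "(Psi v (yvec []) \<otimes>\<^sub>V eta v \<alpha>) u = insert_cup v 0 (eta v \<alpha>) u" for u
  proof (cases "2 \<le> length u")
    case True
    then obtain a b w where u: "u = a # b # w" by (auto simp: numeral_2_eq_2 Suc_le_length_iff)
    show ?thesis
      using Psi_eq[of v "yvec []" a "[]" b]
      by (simp add: u tensor_eq[OF cup] insert_cup_def) (simp add: yvec_def)
  next
    case False
    then show ?thesis by (simp add: tensor_eq[OF cup] insert_cup_def)
  qed
  then show ?case
    using eta_link[of "[]" \<alpha> v] 0 by (auto simp: one_factor_iff fun_eq_iff)
next
  case (Suc k)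
  show ?case
  proof (cases "one_factor (replicate k 1 @ \<alpha>)")
    case True
    then have "one_factor (replicate k 1 @ [1, -1] @ \<alpha>)" by (simp only: one_factor_insert_iff)
    from eta_defect[OF this, of v] show ?thesis
      using Suc.IH[OF True] eta_defect[OF True, of v] by (simp add: insert_cup_yvec_tensor)
  next
    case False
    moreover have set: "set (replicate k 1 @ \<alpha>) \<subseteq> {1, -1}"
      using Suc.prems by (auto simp: one_factor_iff)
    ultimately obtain x y where xy: "replicate k 1 @ \<alpha> = x @ (-1) # y" "one_factor x" "sum_list x = 0"
      by (metis first_return)
    have "k \<le> length x"
    proof (rule ccontr)
      assume "\<not> k \<le> length x"
      then have "(replicate k 1 @ \<alpha>) ! length x = 1" by (simp add: nth_append)
      then show False by (simp add: xy)
    qed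
    then have "take k x = replicate k 1" using arg_cong[OF xy(1), of "take k"] by simp
    then obtain x2 where x: "x = replicate k 1 @ x2" by (metis append_take_drop_id)
    then have \<alpha>: "\<alpha> = x2 @ (-1) # y" using xy by simp
    have y: "set y \<subseteq> {1, -1}" using set by (auto simp: \<alpha>)
    have IH: "eta v (replicate k 1 @ [1, -1] @ x2) = insert_cup v k (eta v x)"
      using Suc.IH[of x2] xy(2) by (simp add: x)
    have x': "one_factor (replicate k 1 @ [1, -1] @ x2)" "sum_list (replicate k 1 @ [1, -1] @ x2) = 0"
      using xy(2,3) by (simp_all only: one_factor_insert_iff x) simp
    have "eta v (replicate (Suc k) 1 @ [1, -1] @ \<alpha>) = Psi v (insert_cup v k (eta v x)) \<otimes>\<^sub>V eta v y"
      using eta_link[OF x' y, of v] IH by (simp add: \<alpha>)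
    also have "\<dots> = insert_cup v (Suc k) (Psi v (eta v x) \<otimes>\<^sub>V eta v y)"
      using \<open>k \<le> length x\<close> insert_cup_Psi[OF eta_in_tensor_power, of k x v v]
        insert_cup_tensor[OF Psi_in_tensor_power[OF eta_in_tensor_power], of "Suc k" x v v v]
      by simp
    also have "Psi v (eta v x) \<otimes>\<^sub>V eta v y = eta v (replicate (Suc k) 1 @ \<alpha>)"
      using eta_link[OF xy(2,3) y, of v] by (simp add: \<alpha> x)
    finally show ?thesis .
  qed
qed

section \<open>Pairings and coefficients after insertion of a neighbouring pair\<close>

lemma height_insert:
  assumes "length x = p"
  shows "height (x @ [1, -1] @ y) k =
    (if k \<le> p then height (x @ y) k else if k = Suc p then height (x @ y) p + 1 else height (x @ y) (k - 2))"
proof -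
  consider "k \<le> p" | "k = Suc p" | j where "k = Suc (Suc (p + j))"
    by (metis Suc_lessI add_Suc less_iff_Suc_add not_less)
  then show ?thesis using assms by cases auto
qed

lemma nth_insert:
  assumes "length x = p"
  shows "(x @ [a, b] @ y) ! k =
    (if k < p then (x @ y) ! k else if k = p then a else if k = Suc p then b else (x @ y) ! (k - 2))"
proof -
  consider "k \<le> p" | "k = Suc p" | j where "k = Suc (Suc (p + j))"
    by (metis Suc_lessI add_Suc less_iff_Suc_add not_less)
  then show ?thesis using assms by cases (auto simp: nth_append)
qed

text \<open>
  The increasing enumeration of all positions other than \<open>p\<close> and \<open>p + 1\<close>.
\<close>

definition skip :: "nat \<Rightarrow> nat \<Rightarrow> nat" where
  "skip p i = (if i < p then i else i + 2)"

lemma skip_cases: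
  obtains "i' = p" | "i' = Suc p" | i where "i' = skip p i"
proof -
  have "i' = skip p i'" if "i' < p" using that by (simp add: skip_def)
  moreover have "i' = skip p (i' - 2)" if "p + 2 \<le> i'" unfolding skip_def using that by arith
  ultimately show ?thesis using that by (metis Suc_lessI add_2_eq_Suc' le_less_linear less_antisym not_less_eq)
qed

text \<open>
  Insertion of \<open>1, -1\<close> adds one peak to the path of partial sums, of height one above its
  surroundings.  An old pairing that encloses the peak stays strictly below it, so first returns
  do not change.
\<close>

lemma pairings_insert:
  assumes len: "length x = p" and set: "set (x @ y) \<subseteq> {1, -1}"
  shows "pairings (x @ [1, -1] @ y) = insert (p, Suc p) (map_prod (skip p) (skip p) ` pairings (x @ y))"
proof -
  define A where "A = x @ y"
  define B where "B = x @ [1, -1] @ y"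
  have setA: "set A \<subseteq> {1, -1}" and setB: "set B \<subseteq> {1, -1}" using set by (auto simp: A_def B_def)
  note A_iff = mem_pairings_iff[OF setA] and B_iff = mem_pairings_iff[OF setB]
  have h: "height B k = (if k \<le> p then height A k else if k = Suc p then height A p + 1 else height A (k - 2))" for k
    unfolding A_def B_def by (rule height_insert[OF len])
  have n: "B ! k = (if k < p then A ! k else if k = p then 1 else if k = Suc p then -1 else A ! (k - 2))" for k
    unfolding A_def B_def by (rule nth_insert[OF len])
  have lB: "length B = length A + 2" and lA: "p \<le> length A" using len by (simp_all add: A_def B_def)
  have hs: "height B (skip p i) = height A i" "height B (Suc (skip p i)) = height A (Suc i)"
    and ns: "B ! skip p i = A ! i" for i
    by (auto simp: skip_def h n)
  have p: "(p, Suc p) \<in> pairings B"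
    unfolding B_iff using lA by (auto simp: h n lB le_Suc_eq)
  have skip: "(skip p i, skip p j) \<in> pairings B \<longleftrightarrow> (i, j) \<in> pairings A" (is "?L \<longleftrightarrow> ?R") for i j
  proof
    assume L: ?L
    have "height A i < height A k" if k: "i < k" "k \<le> j" for k
    proof (cases "k \<le> p")
      case True
      then have "skip p i < k" "k \<le> skip p j" using k by (auto simp: skip_def)
      then have "height B (skip p i) < height B k" using L unfolding B_iff by blast
      then show ?thesis using True hs(1)[of i] h[of k] by simp
    next
      case False
      then have "skip p i < k + 2" "k + 2 \<le> skip p j" using k by (auto simp: skip_def)
      then have "height B (skip p i) < height B (k + 2)" using L unfolding B_iff by blast
      then show ?thesis using False hs(1)[of i] h[of "k + 2"] by simp
    qed
    moreover have "i < j \<and> j < length A"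
      using L lA unfolding B_iff lB by (auto simp: skip_def split: if_splits)
    ultimately show ?R using L unfolding A_iff B_iff hs ns by blast
  next
    assume R: ?R
    then have ij: "i < j" "j < length A" "A ! i = 1" "height A (Suc j) = height A i"
      and pos: "\<And>k. i < k \<Longrightarrow> k \<le> j \<Longrightarrow> height A i < height A k" unfolding A_iff by blast+
    have "height A i < height B k" if k: "skip p i < k" "k \<le> skip p j" for k
    proof -
      consider "k \<le> p" | "k = Suc p" | "Suc p < k" by linarith
      then show ?thesis
      proof cases
        case 1
        then show ?thesis using pos[of k] k by (auto simp: skip_def h split: if_splits)
      next
        case 2
        then show ?thesis using pos[of p] k by (auto simp: skip_def h split: if_splits)
      next
        case 3
        then have "i < k - 2" "k - 2 \<le> j" using k by (auto simp: skip_def split: if_splits)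
        then show ?thesis using pos[of "k - 2"] 3 by (simp add: h)
      qed
    qed
    then show ?L using ij unfolding B_iff lB hs ns by (auto simp: skip_def)
  qed
  show ?thesis
    unfolding A_def[symmetric] B_def[symmetric]
  proof (intro equalityI subsetI)
    fix z assume "z \<in> insert (p, Suc p) (map_prod (skip p) (skip p) ` pairings A)"
    then show "z \<in> pairings B" using p skip by auto
  next
    fix z assume z: "z \<in> pairings B"
    obtain i' j' where ij: "z = (i', j')" by (cases z)
    have zB: "i' < j'" "B ! i' = 1" "height B (Suc j') = height B i'"
      and pos: "\<And>k. i' < k \<Longrightarrow> k \<le> j' \<Longrightarrow> height B i' < height B k"
      using z unfolding ij B_iff by blast+
    show "z \<in> insert (p, Suc p) (map_prod (skip p) (skip p) ` pairings A)"
    proof (cases i' p rule: skip_cases)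
      case 1
      then have "\<not> p + 2 \<le> j'" using pos[of "p + 2"] by (auto simp: h)
      then have "j' = Suc p" using zB(1) 1 by simp
      then show ?thesis using 1 ij by simp
    next
      case 2
      then show ?thesis using zB(2) n[of "Suc p"] by simp
    next
      case (3 i)
      note i = this
      show ?thesis
      proof (cases j' p rule: skip_cases)
        case 1
        then show ?thesis using pos[of p] zB(1,3) by (auto simp: h)
      next
        case 2
        then have "i' < p" using zB(1) i by (auto simp: skip_def split: if_splits)
        then show ?thesis using pos[of p] 2 zB(3) by (auto simp: h)
      next
        case (3 j)
        then show ?thesis using z skip[of i j] by (force simp: ij i)
      qed
    qed
  qed
qed

lemma compatible_insert:
  assumes "length x = p" "length x' = p" "set (x @ y) \<subseteq> {1, -1}"
  shows "compatible (x @ [1, -1] @ y) (x' @ [a, b] @ y') \<longleftrightarrow> a = - b \<and> compatible (x @ y) (x' @ y')"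
proof -
  have "(x' @ [a, b] @ y') ! skip p i = (x' @ y') ! i" for i
    unfolding nth_insert[OF assms(2)] by (simp add: skip_def)
  moreover have "(x' @ [a, b] @ y') ! p = a" "(x' @ [a, b] @ y') ! Suc p = b"
    unfolding nth_insert[OF assms(2)] by simp_all
  ultimately show ?thesis
    unfolding compatible_def pairings_insert[OF assms(1,3)] by (auto simp: map_prod_def split: prod.splits)
qed

lemma finite_pairings: "finite (pairings \<alpha>)"
  by (rule finite_subset[of _ "{..<length \<alpha>} \<times> {..<length \<alpha>}"]) (auto simp: pairings_def)

lemma card_pairings_insert:
  assumes "set (x @ y) \<subseteq> {1, -1}"
  shows "card (pairings (x @ [1, -1] @ y)) = Suc (card (pairings (x @ y)))"
proof -
  let ?p = "length x"
  have inj: "inj (skip ?p)" by (auto simp: inj_on_def skip_def split: if_splits)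
  have "(?p, Suc ?p) \<notin> map_prod (skip ?p) (skip ?p) ` pairings (x @ y)"
    by (auto simp: skip_def split: if_splits)
  then show ?thesis
    using pairings_insert[OF refl assms] card_image[OF inj_on_subset[OF prod.inj_map[OF inj inj] subset_UNIV]]
    by (simp add: finite_pairings)
qed

lemma one_factor_replicate: "one_factor (replicate k 1)"
  by (induction k) (simp_all add: one_factor_snoc sum_list_replicate flip: replicate_append_same)

text \<open>
  The pair that is taken out consists of the first entry \<open>-1\<close> and the entry \<open>1\<close> before it.
\<close>

lemma one_factor_insert_induct [consumes 1, case_names defects insert]:
  assumes "one_factor \<alpha>"
    and "\<And>k. P (replicate k 1)"
    and "\<And>k \<alpha>. one_factor (replicate k 1 @ \<alpha>) \<Longrightarrow> P (replicate k 1 @ \<alpha>) \<Longrightarrow> P (replicate k 1 @ [1, -1] @ \<alpha>)"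
  shows "P \<alpha>"
  using assms(1)
proof (induction \<alpha> rule: length_induct)
  case (1 \<alpha>)
  show ?case
  proof (cases "-1 \<in> set \<alpha>")
    case False
    then have "\<alpha> = replicate (length \<alpha>) 1"
      using one_factor_set[OF 1(2)] by (intro replicate_eqI) auto
    then show ?thesis using assms(2) by metis
  next
    case True
    then obtain x y where \<alpha>: "\<alpha> = x @ (-1) # y" and "-1 \<notin> set x" by (metis split_list_first)
    then have "x = replicate (length x) 1"
      using one_factor_set[OF 1(2)] by (intro replicate_eqI) auto
    moreover have "x \<noteq> []"
      using 1(2) one_factor_appendD[of "[-1]" y] one_factor_sum_nonneg[of "[-1]"] by (auto simp: \<alpha>)
    ultimately obtain k where x: "x = replicate k 1 @ [1]"
      by (metis length_0_conv not0_implies_Suc replicate_append_same replicate_Suc)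
    then have "one_factor (replicate k 1 @ y)"
      using 1(2) one_factor_insert_iff[of "replicate k 1" y] by (simp add: \<alpha>)
    then show ?thesis using 1(1) assms(3)[of k y] by (simp add: \<alpha> x)
  qed
qed

lemma pairings_replicate: "pairings (replicate k 1) = {}"
proof -
  have "set (replicate k 1) \<subseteq> {1, -1::int}" by auto
  then show ?thesis by (auto simp: mem_pairings_iff sum_list_replicate)
qed

lemma sum_list_eq_pairings:
  "one_factor \<alpha> \<Longrightarrow> sum_list \<alpha> = int (length \<alpha>) - 2 * int (card (pairings \<alpha>))"
proof (induction rule: one_factor_insert_induct)
  case (defects k)
  then show ?case by (simp add: pairings_replicate sum_list_replicate)
next
  case (insert k \<alpha>)
  then show ?case using card_pairings_insert[OF one_factor_set[OF insert(1)]] by simp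
qed

lemma neg_positions_snoc:
  "neg_positions (\<beta> @ [b]) = neg_positions \<beta> @ (if b = -1 then [length \<beta>] else [])"
proof -
  have "filter (\<lambda>i. (\<beta> @ [b]) ! i = -1) [0..<length \<beta>] = filter (\<lambda>i. \<beta> ! i = -1) [0..<length \<beta>]"
    by (intro filter_cong refl) (simp add: nth_append)
  then show ?thesis by (simp add: neg_positions_def)
qed

lemma neg_positions_less: "i \<in> set (neg_positions \<beta>) \<Longrightarrow> i < length \<beta> \<and> \<beta> ! i = -1"
  by (auto simp: neg_positions_def)

lemma sum_list_eq_neg_positions:
  "set \<beta> \<subseteq> {1, -1} \<Longrightarrow> sum_list \<beta> = int (length \<beta>) - 2 * int (length (neg_positions \<beta>))"
  by (induction \<beta> rule: rev_induct) (auto simp: neg_positions_snoc, simp add: neg_positions_def)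

lemma card_pairings: "one_factor \<beta> \<Longrightarrow> card (pairings \<beta>) = length (neg_positions \<beta>)"
  using sum_list_eq_pairings[of \<beta>] sum_list_eq_neg_positions[OF one_factor_set, of \<beta>] by simp

definition link_coeff :: "'a::field \<Rightarrow> int \<Rightarrow> int \<Rightarrow> 'a" where
  "link_coeff v a s = qint v (if a = 1 then - s else s + 1) / (qint v s * qint v (s + 1))"

definition coeff_prod :: "'a::field \<Rightarrow> int list \<Rightarrow> int list \<Rightarrow> 'a" where
  "coeff_prod v \<alpha> \<beta> = (\<Prod>i\<leftarrow>neg_positions \<beta>. link_coeff v (\<alpha> ! i) (height \<beta> i))"

lemma coeff_prod_eq:
  assumes "length (neg_positions \<beta>) = m"
  shows "coeff_prod v \<alpha> \<beta> =
    (\<Prod>j=1..m. qint v (s'_seq \<alpha> \<beta> j) / (qint v (s_seq \<beta> j) * qint v (s_seq \<beta> j + 1)))"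
proof -
  have "coeff_prod v \<alpha> \<beta> =
     (\<Prod>j=0..<m. qint v (s'_seq \<alpha> \<beta> (Suc j)) / (qint v (s_seq \<beta> (Suc j)) * qint v (s_seq \<beta> (Suc j) + 1)))"
    using assms
    by (simp add: coeff_prod_def prod.list_conv_set_nth link_coeff_def s'_seq_def s_seq_def cong: if_cong)
  also have "\<dots> = (\<Prod>j=1..m. qint v (s'_seq \<alpha> \<beta> j) / (qint v (s_seq \<beta> j) * qint v (s_seq \<beta> j + 1)))"
    by (simp add: prod.atLeast1_atMost_eq lessThan_atLeast0)
  finally show ?thesis .
qed

lemma coeff_prod_snoc:
  assumes "length \<alpha> = length \<beta>"
  shows "coeff_prod v (\<alpha> @ [a]) (\<beta> @ [b]) =
    coeff_prod v \<alpha> \<beta> * (if b = -1 then link_coeff v a (sum_list \<beta>) else 1)"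
proof -
  have eq: "map (\<lambda>i. link_coeff v ((\<alpha> @ [a]) ! i) (height (\<beta> @ [b]) i)) (neg_positions \<beta>) =
        map (\<lambda>i. link_coeff v (\<alpha> ! i) (height \<beta> i)) (neg_positions \<beta>)"
    using assms by (auto simp: nth_append dest!: neg_positions_less)
  show ?thesis
    by (simp only: coeff_prod_def neg_positions_snoc map_append prod_list.append eq)
      (simp add: assms nth_append)
qed

text \<open>
  The inserted pair has sum \<open>0\<close>, so the levels at all other descents of \<open>\<beta>\<close> are kept and exactly
  one factor is new.
\<close>

lemma coeff_prod_insert:
  assumes "length x = length x'" "length y = length y'"
  shows "coeff_prod v (x @ [1, -1] @ y) (x' @ [1, -1] @ y') =
      coeff_prod v (x @ y) (x' @ y') * link_coeff v (-1) (sum_list x' + 1)"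
    and "coeff_prod v (x @ [1, -1] @ y) (x' @ [-1, 1] @ y') =
      coeff_prod v (x @ y) (x' @ y') * link_coeff v 1 (sum_list x')"
proof -
  have "coeff_prod v (x @ [1, -1] @ y) (x' @ [1, -1] @ y') =
      coeff_prod v (x @ y) (x' @ y') * link_coeff v (-1) (sum_list x' + 1) \<and>
    coeff_prod v (x @ [1, -1] @ y) (x' @ [-1, 1] @ y') =
      coeff_prod v (x @ y) (x' @ y') * link_coeff v 1 (sum_list x')"
    using assms(2)
  proof (induction y arbitrary: y' rule: rev_induct)
    case Nil
    then show ?case
      using assms(1) coeff_prod_snoc[of x x' v 1 1] coeff_prod_snoc[of "x @ [1]" "x' @ [1]" v "-1" "-1"]
        coeff_prod_snoc[of x x' v 1 "-1"] coeff_prod_snoc[of "x @ [1]" "x' @ [-1]" v "-1" 1]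
      by simp
  next
    case (snoc a y)
    then obtain w b where y': "y' = w @ [b]" "length y = length w"
      by (cases y' rule: rev_cases) auto
    have "coeff_prod v ((x @ [1, -1] @ y) @ [a]) ((x' @ [c, d] @ w) @ [b]) =
        coeff_prod v (x @ [1, -1] @ y) (x' @ [c, d] @ w) *
          (if b = -1 then link_coeff v a (sum_list (x' @ [c, d] @ w)) else 1)" for c d
      using assms(1) y'(2) by (intro coeff_prod_snoc) simp
    moreover have "coeff_prod v ((x @ y) @ [a]) ((x' @ w) @ [b]) =
        coeff_prod v (x @ y) (x' @ w) * (if b = -1 then link_coeff v a (sum_list (x' @ w)) else 1)"
      using assms(1) y'(2) by (intro coeff_prod_snoc) simp
    ultimately show ?case using snoc.IH[OF y'(2)] by (simp add: y'(1))
  qed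
  then show "coeff_prod v (x @ [1, -1] @ y) (x' @ [1, -1] @ y') =
      coeff_prod v (x @ y) (x' @ y') * link_coeff v (-1) (sum_list x' + 1)"
    and "coeff_prod v (x @ [1, -1] @ y) (x' @ [-1, 1] @ y') =
      coeff_prod v (x @ y) (x' @ y') * link_coeff v 1 (sum_list x')" by blast+
qed

section \<open>The transpose of \<open>F\<close> and orthogonality\<close>

text \<open>
  The words that occur here are reversed, because the coproduct rule strips tensor factors from the
  right.
\<close>

fun F_transpose_rev :: "'a::field \<Rightarrow> (int list \<Rightarrow> 'a) \<Rightarrow> int list \<Rightarrow> 'a" where
  "F_transpose_rev v f [] = 0"
| "F_transpose_rev v f (a # w) =
     v powi (- a) * F_transpose_rev v (\<lambda>x. f (a # x)) w + (if a = 1 then f (-1 # w) else 0)"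

text \<open>
  The adjoint of \<open>F\<close> for the bilinear form, which acts like the raising operator of
  \<open>U\<^sub>q(sl\<^sub>2)\<close> up to powers of \<open>K\<close>; its defining recursion is the transpose of the coproduct rule
  for \<open>F\<close>.
\<close>

definition F_transpose :: "'a::field \<Rightarrow> (int list \<Rightarrow> 'a) \<Rightarrow> int list \<Rightarrow> 'a" where
  "F_transpose v f u = F_transpose_rev v (\<lambda>x. f (rev x)) (rev u)"

lemma F_transpose_Nil [simp]: "F_transpose v f [] = 0"
  by (simp add: F_transpose_def)

lemma F_transpose_snoc:
  "F_transpose v f (u @ [a]) =
     v powi (- a) * F_transpose v (\<lambda>w. f (w @ [a])) u + (if a = 1 then f (u @ [-1]) else 0)"
  by (simp add: F_transpose_def)

lemma F_transpose_linear:
  "F_transpose v (\<lambda>u. c * f u + d * g u) u = c * F_transpose v f u + d * F_transpose v g u"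
  by (induction u arbitrary: f g rule: rev_induct) (auto simp: F_transpose_snoc algebra_simps)

lemma F_transpose_scale: "F_transpose v (\<lambda>u. c * f u) u = c * F_transpose v f u"
  using F_transpose_linear[of v c f 0 f u] by simp

lemma F_transpose_cong:
  assumes "\<And>w. w \<in> words m \<Longrightarrow> f w = g w" "u \<in> words m"
  shows "F_transpose v f u = F_transpose v g u"
  using assms
proof (induction u arbitrary: f g m rule: rev_induct)
  case (snoc a u)
  then obtain k where m: "m = Suc k" "u \<in> words k" "a = 1 \<or> a = -1"
    by (cases m) (auto simp: words_def)
  have "F_transpose v (\<lambda>w. f (w @ [a])) u = F_transpose v (\<lambda>w. g (w @ [a])) u"
    using snoc.prems(1) m by (intro snoc.IH[of k]) auto
  then show ?case using snoc.prems(1)[of "u @ [-1]"] m by (simp add: F_transpose_snoc)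
qed simp

lemma form_Suc:
  "form (Suc m) f g = form m (\<lambda>w. f (w @ [1])) (\<lambda>w. g (w @ [1])) +
     form m (\<lambda>w. f (w @ [-1])) (\<lambda>w. g (w @ [-1]))"
  by (simp add: form_def sum_words_Suc)

lemma form_cong:
  "(\<And>w. w \<in> words m \<Longrightarrow> f w * g w = f' w * g' w) \<Longrightarrow> form m f g = form m f' g'"
  by (simp add: form_def)

lemma form_linear_left: "form m (\<lambda>w. c * f w + d * f' w) g = c * form m f g + d * form m f' g"
  by (simp add: form_def algebra_simps sum.distrib sum_distrib_left)

lemma form_commute: "form m f g = form m g f"
  by (simp add: form_def mult.commute)

lemma form_scale: "form m (\<lambda>w. c * f w) g = c * form m f g" "form m g (\<lambda>w. c * f w) = c * form m g f"
  by (simp_all add: form_def sum_distrib_left mult.assoc mult.left_commute)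

lemma form_sum: "form m (\<lambda>w. \<Sum>x\<in>A. c x * f x w) g = (\<Sum>x\<in>A. c x * form m (f x) g)"
  unfolding form_def sum_distrib_right sum_distrib_left
  by (subst sum.swap) (simp add: mult.assoc)

lemma form_F_transpose: "form m (F_transpose v f) g = form m f (F_op v g)"
proof (induction m arbitrary: f g)
  case 0
  show ?case by (simp add: form_def)
next
  case (Suc m)
  let ?f1 = "\<lambda>w. f (w @ [1])" and ?f2 = "\<lambda>w. f (w @ [-1])"
  let ?g1 = "\<lambda>w. g (w @ [1])" and ?g2 = "\<lambda>w. g (w @ [-1])"
  have slices: "(\<lambda>w. F_transpose v f (w @ [1])) = (\<lambda>w. inverse v * F_transpose v ?f1 w + 1 * ?f2 w)"
    "(\<lambda>w. F_transpose v f (w @ [-1])) = (\<lambda>w. v * F_transpose v ?f2 w)"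
    by (simp_all add: F_transpose_snoc fun_eq_iff)
  have "form (Suc m) (F_transpose v f) g =
      (inverse v * form m (F_transpose v ?f1) ?g1 + 1 * form m ?f2 ?g1) + v * form m (F_transpose v ?f2) ?g2"
    by (simp only: form_Suc slices form_linear_left form_scale)
  also have "\<dots> = inverse v * form m ?f1 (F_op v ?g1) + (v * form m (F_op v ?g2) ?f2 + 1 * form m ?g1 ?f2)"
    by (simp add: Suc.IH form_commute[of m "F_op v ?g2"] form_commute[of m ?g1])
  also have "\<dots> = form m ?f1 (\<lambda>w. F_op v g (w @ [1])) + form m ?f2 (\<lambda>w. F_op v g (w @ [-1]))"
  proof -
    have "form m ?f2 (\<lambda>w. F_op v g (w @ [-1])) = form m (\<lambda>w. v * F_op v ?g2 w + 1 * ?g1 w) ?f2"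
      by (rule form_cong) (simp add: F_op_snoc_minus1 mult.commute)
    then show ?thesis by (simp only: form_linear_left F_op_snoc1 form_scale)
  qed
  also have "\<dots> = form (Suc m) f (F_op v g)" by (simp only: form_Suc)
  finally show ?case .
qed

definition commutator_weight :: "'a::field \<Rightarrow> int \<Rightarrow> 'a" where
  "commutator_weight v s = v powi (1 - s) * qint v s"

lemma commutator_weight_add_one:
  assumes "v \<noteq> 0"
  shows "v\<^sup>2 * commutator_weight v (s + 1) = commutator_weight v s + v\<^sup>2"
proof -
  have p: "v powi (1 - s) = v * v powi (- s)" "v powi (- s) * v powi s = 1"
    using assms powi_shift(1)[OF assms, of "- s"] by (simp_all add: power_int_minus)
  have "v\<^sup>2 * commutator_weight v (s + 1) = v\<^sup>2 * (v powi (- s) * (inverse v * qint v s + v powi s))"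
    by (simp add: commutator_weight_def qint_add_one(2)[OF assms])
  also have "\<dots> = v * v powi (- s) * qint v s + v\<^sup>2 * (v powi (- s) * v powi s)"
    using assms by (simp add: field_simps power2_eq_square)
  finally show ?thesis by (simp add: commutator_weight_def p)
qed

text \<open>
  With \<open>E\<close> for the transpose, \<open>E F - v\<^sup>2 F E\<close> is diagonal: on \<open>W \<otimes> V\<close> the mixed terms cancel because
  \<open>K\<inverse> F = v\<^sup>2 F K\<inverse>\<close> and \<open>E K\<inverse> = v\<^sup>2 K\<inverse> E\<close>, and the scalar in weight \<open>s\<close> obeys the recursion of
  \<open>v\<^bsup>1-s\<^esup> [s]\<close>.
\<close>

lemma F_transpose_F_op:
  fixes v :: "'a::field"
  assumes "v \<noteq> 0" "u \<in> words m"
  shows "F_transpose v (F_op v f) u =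
    v\<^sup>2 * F_op v (F_transpose v f) u + commutator_weight v (sum_list u) * f u"
  using assms(2)
proof (induction u arbitrary: f m rule: rev_induct)
  case Nil
  show ?case by (simp add: commutator_weight_def)
next
  case (snoc a u)
  then obtain k where u: "u \<in> words k" and a: "a = 1 \<or> a = -1"
    by (cases m) (auto simp: words_def)
  let ?f1 = "\<lambda>w. f (w @ [1])" and ?f2 = "\<lambda>w. f (w @ [-1])"
  show ?case
    using a
  proof
    assume a: "a = 1"
    have lhs: "F_transpose v (F_op v f) (u @ [1]) =
        inverse v * (inverse v * F_transpose v (F_op v ?f1) u) + (v * F_op v ?f2 u + f (u @ [1]))"
      by (simp add: F_transpose_snoc F_op_snoc1 F_transpose_scale F_op_snoc_minus1[OF u])
    have rhs: "F_op v (F_transpose v f) (u @ [1]) =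
        inverse v * (inverse v * F_op v (F_transpose v ?f1) u + 1 * F_op v ?f2 u)"
      unfolding F_op_linear[symmetric] by (simp add: F_transpose_snoc F_op_snoc1)
    have weight: "commutator_weight v (sum_list (u @ [1])) =
        inverse v * inverse v * commutator_weight v (sum_list u) + 1"
      using commutator_weight_add_one[OF assms(1), of "sum_list u"] assms(1)
      by (simp add: field_simps power2_eq_square)
    show ?thesis
      unfolding a lhs rhs weight snoc.IH[OF u, of ?f1]
      using assms(1) by (simp add: field_simps power2_eq_square)
  next
    assume a: "a = -1"
    have "F_transpose v (\<lambda>w. F_op v f (w @ [-1])) u = F_transpose v (\<lambda>w. v * F_op v ?f2 w + 1 * ?f1 w) u"
      using u by (intro F_transpose_cong[of k]) (auto simp: F_op_snoc_minus1)
    then have lhs: "F_transpose v (F_op v f) (u @ [-1]) =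
        v * (v * F_transpose v (F_op v ?f2) u + 1 * F_transpose v ?f1 u)"
      unfolding F_transpose_linear by (simp add: F_transpose_snoc)
    have rhs: "F_op v (F_transpose v f) (u @ [-1]) =
        v * (v * F_op v (F_transpose v ?f2) u) + (inverse v * F_transpose v ?f1 u + f (u @ [-1]))"
      by (simp add: F_op_snoc_minus1[OF u] F_transpose_snoc F_op_scale)
    have weight: "commutator_weight v (sum_list (u @ [-1])) = v\<^sup>2 * commutator_weight v (sum_list u) - v\<^sup>2"
      using commutator_weight_add_one[OF assms(1), of "sum_list u - 1"] by simp
    show ?thesis
      unfolding a lhs rhs weight snoc.IH[OF u, of ?f2]
      using assms(1) by (simp add: field_simps power2_eq_square)
  qed
qed

lemma mu_weight: "set \<beta> \<subseteq> {1, -1} \<Longrightarrow> mu v \<beta> w \<noteq> 0 \<Longrightarrow> sum_list w = sum_list \<beta>"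
  using mu_homogeneous[of \<beta> v] by (auto simp: has_weight_def)

lemma F_transpose_F_op_mu_aux:
  fixes v :: "'a::field"
  assumes "v \<noteq> 0" "set \<beta> \<subseteq> {1, -1}" "w \<in> words (length \<beta>)"
    and "\<And>x. x \<in> words (length \<beta>) \<Longrightarrow> F_transpose v (mu v \<beta>) x = 0"
  shows "F_transpose v (F_op v (mu v \<beta>)) w = commutator_weight v (sum_list \<beta>) * mu v \<beta> w"
proof -
  have "F_op v (F_transpose v (mu v \<beta>)) w = F_op v (\<lambda>x. 0) w"
    using assms(3,4) by (intro F_op_cong) (auto simp: words_def)
  then show ?thesis
    using F_transpose_F_op[OF assms(1,3), of "mu v \<beta>"] mu_weight[OF assms(2), of v w]
    by (cases "mu v \<beta> w = 0") simp_all
qed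

text \<open>
  The vectors \<open>mu\<close> are highest weight vectors.  For \<open>Phi2\<close> the commutation relation makes the two
  terms \<open>[s] b\<close> and \<open>v\<^bsup>s-1\<^esup> E F b\<close> equal.
\<close>

lemma F_transpose_mu:
  fixes v :: "'a::field"
  assumes "v \<noteq> 0" "set \<beta> \<subseteq> {1, -1}" "u \<in> words (length \<beta>)"
  shows "F_transpose v (mu v \<beta>) u = 0"
  using assms(2,3)
proof (induction \<beta> arbitrary: u rule: rev_induct)
  case (snoc b \<beta>)
  let ?b = "mu v \<beta>" and ?s = "sum_list \<beta>"
  have \<beta>: "set \<beta> \<subseteq> {1, -1}" using snoc.prems by simp
  have IH: "F_transpose v ?b x = 0" if "x \<in> words (length \<beta>)" for x using snoc.IH[OF \<beta> that] .
  obtain w a where u: "u = w @ [a]" and w: "w \<in> words (length \<beta>)" and a: "a = 1 \<or> a = -1"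
    using snoc.prems(2) by (auto simp: words_Suc)
  have zero: "F_transpose v (\<lambda>w. 0) w = 0" using F_transpose_scale[of v 0 "\<lambda>w. 0" w] by simp
  have p: "v powi (?s - 1) * v powi (1 - ?s) = 1"
    using assms(1) by (simp flip: power_int_add)
  have "F_transpose v (Phi1 ?b) u = 0"
    using a IH[OF w] zero by (auto simp: u F_transpose_snoc)
  moreover have "F_transpose v (Phi2 v ?s ?b) u = 0"
    using a
  proof
    assume "a = 1"
    have aux: "F_transpose v (F_op v ?b) w = commutator_weight v ?s * ?b w"
      by (rule F_transpose_F_op_mu_aux[OF assms(1) \<beta> w]) (rule IH)
    have "F_transpose v (Phi2 v ?s ?b) (w @ [1]) =
        inverse v * (- (v powi ?s) * F_transpose v (F_op v ?b) w) + qint v ?s * ?b w"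
      by (simp only: F_transpose_snoc F_transpose_scale[symmetric]) simp
    also have "\<dots> = (1 - v powi (?s - 1) * v powi (1 - ?s)) * qint v ?s * ?b w"
      unfolding aux powi_shift(2)[OF assms(1), of ?s]
      by (simp add: commutator_weight_def algebra_simps)
    finally show ?thesis using p \<open>a = 1\<close> by (simp add: u)
  next
    assume "a = -1"
    then show ?thesis using IH[OF w] by (simp add: u F_transpose_snoc F_transpose_scale)
  qed
  ultimately show ?case by (simp add: mu_snoc)
qed simp

definition mu_norm :: "'a::field \<Rightarrow> int list \<Rightarrow> 'a" where
  "mu_norm v \<beta> = (\<Prod>i\<leftarrow>neg_positions \<beta>. v * qint v (height \<beta> i) * qint v (height \<beta> i + 1))"

lemma mu_norm_snoc:
  "mu_norm v (\<beta> @ [b]) =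
    mu_norm v \<beta> * (if b = -1 then v * qint v (sum_list \<beta>) * qint v (sum_list \<beta> + 1) else 1)"
proof -
  have eq: "map (\<lambda>i. v * qint v (height (\<beta> @ [b]) i) * qint v (height (\<beta> @ [b]) i + 1)) (neg_positions \<beta>) =
        map (\<lambda>i. v * qint v (height \<beta> i) * qint v (height \<beta> i + 1)) (neg_positions \<beta>)"
    by (auto dest!: neg_positions_less)
  show ?thesis
    by (simp only: mu_norm_def neg_positions_snoc map_append prod_list.append eq) simp
qed

text \<open>
  By induction on the last entries.  If they differ, the scalar product is a multiple of
  \<open>\<langle>E b, b'\<rangle> = 0\<close>.  If both are \<open>-1\<close>, moving \<open>F\<close> across the form gives
  \<open>v\<^bsup>2s\<^esup> v\<^bsup>1-s\<^esup> [s] + [s]\<^sup>2 = v [s] [s+1]\<close> as the new factor of the norm.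
\<close>

lemma form_mu:
  fixes v :: "'a::field"
  assumes "v \<noteq> 0" "set \<beta> \<subseteq> {1, -1}" "set \<gamma> \<subseteq> {1, -1}" "length \<beta> = length \<gamma>"
  shows "form (length \<beta>) (mu v \<beta>) (mu v \<gamma>) = (if \<beta> = \<gamma> then mu_norm v \<beta> else 0)"
  using assms(2-4)
proof (induction \<beta> arbitrary: \<gamma> rule: rev_induct)
  case Nil
  then show ?case by (simp add: form_def mu_Nil yvec_def mu_norm_def neg_positions_def)
next
  case (snoc b \<beta>)
  then obtain \<gamma>' c where \<gamma>: "\<gamma> = \<gamma>' @ [c]" and len: "length \<beta> = length \<gamma>'"
    by (cases \<gamma> rule: rev_cases) auto
  let ?m = "length \<beta>" and ?b = "mu v \<beta>" and ?c = "mu v \<gamma>'"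
  let ?s = "sum_list \<beta>" and ?t = "sum_list \<gamma>'"
  have sets: "set \<beta> \<subseteq> {1, -1}" "set \<gamma>' \<subseteq> {1, -1}" and bc: "b = 1 \<or> b = -1" "c = 1 \<or> c = -1"
    using snoc.prems by (auto simp: \<gamma>)
  have IH: "form ?m ?b ?c = (if \<beta> = \<gamma>' then mu_norm v \<beta> else 0)"
    by (rule snoc.IH[OF sets len])
  have Phi1: "form (Suc ?m) (Phi1 f) g = form ?m f (\<lambda>w. g (w @ [1]))" for f g :: "int list \<Rightarrow> 'a"
    by (simp add: form_Suc) (simp add: form_def)
  have 11: "form (Suc ?m) (Phi1 ?b) (Phi1 ?c) = form ?m ?b ?c"
    by (simp add: Phi1)
  have 12: "form (Suc ?m) (Phi1 (mu v x)) (Phi2 v s (mu v y)) = 0"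
    if "set x \<subseteq> {1, -1}" "length x = ?m" for x y s
  proof -
    have "form (Suc ?m) (Phi1 (mu v x)) (Phi2 v s (mu v y)) = - (v powi s) * form ?m (F_transpose v (mu v x)) (mu v y)"
      unfolding form_F_transpose form_scale(2)[symmetric] Phi1 by simp
    also have "form ?m (F_transpose v (mu v x)) (mu v y) = 0"
      unfolding form_def using that F_transpose_mu[OF assms(1) that(1)] by (intro sum.neutral) simp
    finally show ?thesis by simp
  qed
  have FF: "form ?m (F_op v ?b) (F_op v ?c) = commutator_weight v ?s * form ?m ?b ?c"
    unfolding form_F_transpose[symmetric] form_scale(1)[symmetric]
    using F_transpose_F_op_mu_aux[OF assms(1) sets(1) _ F_transpose_mu[OF assms(1) sets(1)]]
    by (intro form_cong) simp
  have 22: "form (Suc ?m) (Phi2 v ?s ?b) (Phi2 v ?t ?c) =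
      (v powi ?s * v powi ?t * commutator_weight v ?s + qint v ?s * qint v ?t) * form ?m ?b ?c"
  proof -
    have slices: "(\<lambda>w. Phi2 v s f (w @ [1])) = (\<lambda>w. - (v powi s) * F_op v f w)"
      "(\<lambda>w. Phi2 v s f (w @ [-1])) = (\<lambda>w. qint v s * f w)" for s f by auto
    have "form (Suc ?m) (Phi2 v ?s ?b) (Phi2 v ?t ?c) =
      - (v powi ?s) * (- (v powi ?t) * form ?m (F_op v ?b) (F_op v ?c)) + qint v ?s * (qint v ?t * form ?m ?b ?c)"
      by (simp only: form_Suc slices form_scale)
    then show ?thesis by (simp add: FF algebra_simps)
  qed
  have norm: "v powi ?s * v powi ?s * commutator_weight v ?s + qint v ?s * qint v ?s = v * qint v ?s * qint v (?s + 1)"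
  proof -
    have "v powi ?s * v powi (1 - ?s) = v"
      using assms(1) by (simp flip: power_int_add)
    then have h: "v powi ?s * v powi ?s * commutator_weight v ?s = v * v powi ?s * qint v ?s"
      by (simp add: commutator_weight_def)
    show ?thesis
      unfolding h qint_add_one(2)[OF assms(1)] using assms(1) by (simp add: algebra_simps)
  qed
  consider "b = 1" "c = 1" | "b = 1" "c = -1" | "b = -1" "c = 1" | "b = -1" "c = -1"
    using bc by blast
  then show ?case
  proof cases
    case 1
    then show ?thesis using 11 IH by (simp add: \<gamma> mu_snoc mu_norm_snoc)
  next
    case 2
    then show ?thesis using 12[OF sets(1) refl] by (simp add: \<gamma> mu_snoc)
  next
    case 3
    then show ?thesis using 12[OF sets(2) len[symmetric]] by (simp add: \<gamma> mu_snoc form_commute)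
  next
    case 4
    then show ?thesis
      using 22 IH norm by (cases "\<beta> = \<gamma>'") (auto simp: \<gamma> mu_snoc mu_norm_snoc mult.assoc)
  qed
qed

lemma sum_list_le_length: "set w \<subseteq> {1, -1} \<Longrightarrow> sum_list w \<le> int (length w)"
  using sum_list_eq_neg_positions[of w] by simp

lemma neg_position_height:
  assumes "one_factor \<beta>" "i \<in> set (neg_positions \<beta>)"
  shows "1 \<le> height \<beta> i" "height \<beta> i + 1 \<le> int (length \<beta>)"
proof -
  have i: "i < length \<beta>" "\<beta> ! i = -1" using neg_positions_less[OF assms(2)] by auto
  have "0 \<le> height \<beta> (Suc i)" using assms(1) by (simp add: one_factor_iff)
  then show "1 \<le> height \<beta> i" using i by (simp add: height_Suc)
  have "set (take i \<beta>) \<subseteq> {1, -1}" using one_factor_set[OF assms(1)] set_take_subset by fast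
  then show "height \<beta> i + 1 \<le> int (length \<beta>)" using sum_list_le_length[of "take i \<beta>"] i by simp
qed

lemma mu_norm_nonzero:
  assumes "v \<noteq> 0" "qfact v n \<noteq> 0" "one_factor \<beta>" "length \<beta> \<le> n"
  shows "mu_norm v \<beta> \<noteq> 0"
  unfolding mu_norm_def prod_list_zero_iff
  using neg_position_height[OF assms(3)] assms qint_nonzero[OF assms(2)] by fastforce

section \<open>The expansion of \<open>eta\<close>\<close>

definition expansion_coeff :: "'a::field \<Rightarrow> int list \<Rightarrow> int list \<Rightarrow> 'a" where
  "expansion_coeff v \<alpha> \<beta> = (if compatible \<alpha> \<beta> then coeff_prod v \<alpha> \<beta> else 0)"

definition weight_words :: "nat \<Rightarrow> int \<Rightarrow> int list set" where
  "weight_words l s = {w \<in> words l. sum_list w = s}"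

lemma finite_weight_words: "finite (weight_words l s)"
  unfolding weight_words_def using finite_words by simp

lemma weight_words_replicate: "weight_words k (int k) = {replicate k 1}"
proof (intro equalityI subsetI)
  fix w assume "w \<in> weight_words k (int k)"
  then have w: "length w = k" "set w \<subseteq> {1, -1}" "sum_list w = int k"
    by (auto simp: weight_words_def words_def)
  then have "neg_positions w = []" using sum_list_eq_neg_positions[of w] by simp
  then have "-1 \<notin> set w" by (auto simp: neg_positions_def in_set_conv_nth filter_empty_conv)
  then have "w = replicate k 1" using w by (intro replicate_eqI) auto
  then show "w \<in> {replicate k 1}" by simp
qed (auto simp: weight_words_def words_def sum_list_replicate)

lemma eta_replicate: "eta v (replicate k 1) = yvec (replicate k 1)"
  using eta_defect[OF one_factor_replicate, of v]
  by (induction k) (simp_all add: tensor_yvec del: eta.simps(2))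

lemma mu_replicate: "mu v (replicate k 1) = yvec (replicate k 1)"
  by (induction k) (simp_all add: mu_Nil mu_snoc Phi1_def tensor_yvec flip: replicate_append_same)

definition insert_pair :: "nat \<Rightarrow> int \<Rightarrow> int list \<Rightarrow> int list" where
  "insert_pair p a \<gamma> = take p \<gamma> @ [a, - a] @ drop p \<gamma>"

lemma split_at_two:
  assumes "p + 2 \<le> length \<beta>"
  shows "\<beta> = take p \<beta> @ [\<beta> ! p, \<beta> ! Suc p] @ drop (p + 2) \<beta>"
  using assms by (simp add: Cons_nth_drop_Suc)

text \<open>
  A word whose entries at \<open>p\<close> and \<open>p + 1\<close> are opposite arises in a unique way from a shorter word
  by inserting \<open>1, -1\<close> or \<open>-1, 1\<close>.
\<close>

lemma sum_weight_words_insert_pair: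
  fixes g :: "int list \<Rightarrow> 'a::comm_monoid_add"
  assumes "p \<le> l" "\<And>\<beta>. length \<beta> = l + 2 \<Longrightarrow> \<beta> ! p \<noteq> - \<beta> ! Suc p \<Longrightarrow> g \<beta> = 0"
  shows "(\<Sum>\<beta>\<in>weight_words (l + 2) s. g \<beta>) =
    (\<Sum>\<gamma>\<in>weight_words l s. g (insert_pair p 1 \<gamma>) + g (insert_pair p (-1) \<gamma>))"
proof -
  let ?S = "insert_pair p 1 ` weight_words l s \<union> insert_pair p (-1) ` weight_words l s"
  have inj: "inj_on (insert_pair p a) (weight_words l s)" for a
  proof (rule inj_onI)
    fix \<gamma> \<delta> assume "\<gamma> \<in> weight_words l s" "\<delta> \<in> weight_words l s" "insert_pair p a \<gamma> = insert_pair p a \<delta>"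
    then have "take p \<gamma> = take p \<delta> \<and> drop p \<gamma> = drop p \<delta>"
      using assms(1) by (auto simp: insert_pair_def weight_words_def words_def)
    then show "\<gamma> = \<delta>" by (metis append_take_drop_id)
  qed
  have sub: "insert_pair p a \<gamma> \<in> weight_words (l + 2) s"
    if "\<gamma> \<in> weight_words l s" "a = 1 \<or> a = -1" for \<gamma> a
  proof -
    have "sum_list (take p \<gamma>) + sum_list (drop p \<gamma>) = sum_list \<gamma>"
      by (metis append_take_drop_id sum_list_append)
    moreover have "set (take p \<gamma>) \<subseteq> set \<gamma>" "set (drop p \<gamma>) \<subseteq> set \<gamma>"
      by (rule set_take_subset set_drop_subset)+
    ultimately show ?thesis
      using that assms(1) by (auto simp: insert_pair_def weight_words_def words_def)
  qed
  have zero: "g \<beta> = 0" if \<beta>: "\<beta> \<in> weight_words (l + 2) s - ?S" for \<beta>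
  proof (rule ccontr)
    assume "g \<beta> \<noteq> 0"
    then have pair: "\<beta> ! Suc p = - \<beta> ! p" using assms(2)[of \<beta>] \<beta> by (force simp: weight_words_def words_def)
    have len: "length \<beta> = l + 2" and set: "set \<beta> \<subseteq> {1, -1}" using \<beta> by (auto simp: weight_words_def words_def)
    define \<gamma> where "\<gamma> = take p \<beta> @ drop (p + 2) \<beta>"
    have split: "\<beta> = take p \<beta> @ [\<beta> ! p, - \<beta> ! p] @ drop (p + 2) \<beta>"
      using split_at_two[of p \<beta>] len assms(1) pair by simp
    have ins: "\<beta> = insert_pair p (\<beta> ! p) \<gamma>"
      using split len assms(1) by (simp add: insert_pair_def \<gamma>_def)
    have "set \<gamma> \<subseteq> {1, -1}"
      using set set_take_subset[of p \<beta>] set_drop_subset[of "p + 2" \<beta>] by (auto simp: \<gamma>_def)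
    moreover have "length \<gamma> = l" using len assms(1) by (simp add: \<gamma>_def)
    moreover have "sum_list \<gamma> = sum_list \<beta>"
      using arg_cong[OF split, of sum_list] by (simp add: \<gamma>_def)
    ultimately have \<gamma>: "\<gamma> \<in> weight_words l s" using \<beta> by (auto simp: weight_words_def words_def)
    have "\<beta> ! p \<in> set \<beta>" using len assms(1) by simp
    then have "\<beta> ! p = 1 \<or> \<beta> ! p = -1" using set by blast
    then have "\<beta> \<in> ?S" using ins \<gamma> by (metis UnI1 UnI2 image_eqI)
    then show False using \<beta> by simp
  qed
  have disj: "insert_pair p 1 ` weight_words l s \<inter> insert_pair p (-1) ` weight_words l s = {}"
    using assms(1) by (auto simp: insert_pair_def weight_words_def words_def)
  have "(\<Sum>\<beta>\<in>weight_words (l + 2) s. g \<beta>) = (\<Sum>\<beta>\<in>?S. g \<beta>)"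
    using sub zero by (intro sum.mono_neutral_right finite_weight_words) auto
  also have "\<dots> = (\<Sum>\<gamma>\<in>weight_words l s. g (insert_pair p 1 \<gamma>)) + (\<Sum>\<gamma>\<in>weight_words l s. g (insert_pair p (-1) \<gamma>))"
    using disj by (simp add: sum.union_disjoint finite_weight_words sum.reindex[OF inj])
  finally show ?thesis by (simp add: sum.distrib)
qed

lemma one_factor_insert_minus_iff:
  "one_factor (x @ [-1, 1] @ y) \<longleftrightarrow> one_factor (x @ y) \<and> 1 \<le> sum_list x"
proof (induction y rule: rev_induct)
  case Nil
  show ?case
    using one_factor_snoc[of "x @ [-1]" 1] one_factor_sum_nonneg[of x]
    by (auto simp: one_factor_snoc)
next
  case (snoc a y)
  then show ?case
    using one_factor_snoc[of "x @ [-1, 1] @ y" a] one_factor_snoc[of "x @ y" a] by auto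
qed

text \<open>
  One term of the induction step.  The relation for cups contributes \<open>1/[s+1]\<close> and \<open>-1/[s+1]\<close>, which
  are the new factors \<open>[s+2]/([s+1][s+2])\<close> and \<open>[-s]/([s][s+1])\<close> of the product.  The last
  cancellation breaks down for \<open>s = 0\<close>, but then the vector it multiplies is zero.
\<close>

lemma insert_cup_expansion_term:
  fixes v :: "'a::field"
  assumes v: "v \<noteq> 0" "qfact v n \<noteq> 0" and n: "length \<alpha> + 2 \<le> n"
    and \<alpha>: "set \<alpha> \<subseteq> {1, -1}" and \<gamma>: "set \<gamma> \<subseteq> {1, -1}" "length \<gamma> = length \<alpha>" and p: "p \<le> length \<alpha>"
  shows "expansion_coeff v \<alpha> \<gamma> * insert_cup v p (mu v \<gamma>) u =
    expansion_coeff v (insert_pair p 1 \<alpha>) (insert_pair p 1 \<gamma>) * mu v (insert_pair p 1 \<gamma>) u +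
    expansion_coeff v (insert_pair p 1 \<alpha>) (insert_pair p (-1) \<gamma>) * mu v (insert_pair p (-1) \<gamma>) u"
proof -
  define x y x' y' where xy: "x = take p \<alpha>" "y = drop p \<alpha>" "x' = take p \<gamma>" "y' = drop p \<gamma>"
  have app: "\<alpha> = x @ y" "\<gamma> = x' @ y'" by (simp_all add: xy)
  have len: "length x = p" "length x' = p" "length y = length y'" using p \<gamma>(2) by (simp_all add: xy)
  have ins: "insert_pair p 1 \<alpha> = x @ [1, -1] @ y" "insert_pair p 1 \<gamma> = x' @ [1, -1] @ y'"
    "insert_pair p (-1) \<gamma> = x' @ [-1, 1] @ y'" by (simp_all add: insert_pair_def xy)
  define s where "s = sum_list x'"
  have set': "set x' \<subseteq> {1, -1}" "set y' \<subseteq> {1, -1}" using \<gamma>(1) by (simp_all add: app)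
  have coeff: "expansion_coeff v (x @ [1, -1] @ y) (x' @ [1, -1] @ y') =
      expansion_coeff v (x @ y) (x' @ y') * link_coeff v (-1) (s + 1)"
    "expansion_coeff v (x @ [1, -1] @ y) (x' @ [-1, 1] @ y') =
      expansion_coeff v (x @ y) (x' @ y') * link_coeff v 1 s"
    using compatible_insert[OF len(1,2), of y _ _ y'] coeff_prod_insert[of x x' y y' v] len \<alpha>
    by (simp_all add: expansion_coeff_def s_def app)
  show ?thesis
  proof (cases "one_factor \<gamma>")
    case False
    then have "mu v \<gamma> = (\<lambda>u. 0)" "mu v (x' @ [1, -1] @ y') = (\<lambda>u. 0)" "mu v (x' @ [-1, 1] @ y') = (\<lambda>u. 0)"
      using \<gamma>(1) set' one_factor_insert_iff[of x' y'] one_factor_insert_minus_iff[of x' y']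
      by (auto intro!: mu_eq_0_if_not_one_factor[OF v(1)] simp: app)
    then show ?thesis unfolding ins by (simp add: insert_cup_def)
  next
    case True
    then have "0 \<le> s" using one_factor_appendD[of x' y'] one_factor_sum_nonneg[of x'] by (simp add: app s_def)
    moreover have "s \<le> int (length \<alpha>)" using sum_list_le_length[OF set'(1)] len p by (simp add: s_def)
    ultimately have q: "qint v (s + 1) \<noteq> 0" "qint v (s + 2) \<noteq> 0"
      using n qint_nonzero[OF v(2), of "s + 1"] qint_nonzero[OF v(2), of "s + 2"] by simp_all
    have cup: "insert_cup v p (mu v \<gamma>) u =
        (mu v (x' @ [1, -1] @ y') u - mu v (x' @ [-1, 1] @ y') u) / qint v (s + 1)"
      using insert_cup_mu[OF v(1) set', of u] q(1) len by (simp add: app s_def field_simps)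
    have plus: "link_coeff v (-1) (s + 1) = 1 / qint v (s + 1)"
      using q by (simp add: link_coeff_def add.assoc)
    have minus: "link_coeff v 1 s * mu v (x' @ [-1, 1] @ y') u = - mu v (x' @ [-1, 1] @ y') u / qint v (s + 1)"
    proof (cases "s = 0")
      case True
      then have "mu v (x' @ [-1, 1] @ y') = (\<lambda>u. 0)"
        using set' one_factor_insert_minus_iff[of x' y']
        by (intro mu_eq_0_if_not_one_factor[OF v(1)]) (auto simp: s_def)
      then show ?thesis by simp
    next
      case False
      then have "qint v s \<noteq> 0"
        using \<open>0 \<le> s\<close> \<open>s \<le> int (length \<alpha>)\<close> n by (intro qint_nonzero[OF v(2)]) auto
      then show ?thesis by (simp add: link_coeff_def qint_minus)
    qed
    show ?thesis
      unfolding ins coeff cup plus mult.assoc minus by (simp add: app diff_divide_distrib algebra_simps)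
  qed
qed

lemma eta_expansion_words:
  fixes v :: "'a::field"
  assumes "one_factor \<alpha>" "v \<noteq> 0" "qfact v n \<noteq> 0" "length \<alpha> \<le> n"
  shows "eta v \<alpha> = (\<lambda>u. \<Sum>\<beta>\<in>weight_words (length \<alpha>) (sum_list \<alpha>). expansion_coeff v \<alpha> \<beta> * mu v \<beta> u)"
  using assms(1,4)
proof (induction rule: one_factor_insert_induct)
  case (defects k)
  have "neg_positions (replicate k 1) = []" by (auto simp: neg_positions_def)
  then have "expansion_coeff v (replicate k 1) (replicate k 1) = 1"
    by (simp add: expansion_coeff_def compatible_def pairings_replicate coeff_prod_def)
  then show ?case
    by (simp add: sum_list_replicate weight_words_replicate eta_replicate mu_replicate)
next
  case (insert k \<alpha>)
  let ?\<alpha> = "replicate k 1 @ \<alpha>"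
  have set: "set ?\<alpha> \<subseteq> {1, -1}" using insert(1) by (rule one_factor_set)
  have ins: "replicate k 1 @ [1, -1] @ \<alpha> = insert_pair k 1 ?\<alpha>" by (simp add: insert_pair_def)
  have "length ?\<alpha> + 2 \<le> n" using insert.prems by simp
  show ?case
  proof
    fix u
    let ?g = "\<lambda>\<beta>. expansion_coeff v (replicate k 1 @ [1, -1] @ \<alpha>) \<beta> * mu v \<beta> u"
    have zero: "?g \<beta> = 0" if "length \<beta> = length ?\<alpha> + 2" "\<beta> ! k \<noteq> - \<beta> ! Suc k" for \<beta>
    proof -
      have "\<not> compatible (replicate k 1 @ [1, -1] @ \<alpha>) (take k \<beta> @ [\<beta> ! k, \<beta> ! Suc k] @ drop (k + 2) \<beta>)"
        using that set by (subst compatible_insert) auto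
      then show ?thesis using split_at_two[of k \<beta>] that(1) by (simp add: expansion_coeff_def)
    qed
    have "eta v (replicate k 1 @ [1, -1] @ \<alpha>) u = insert_cup v k (eta v ?\<alpha>) u"
      using eta_insert[OF insert(1), of v] by simp
    also have "\<dots> = (\<Sum>\<gamma>\<in>weight_words (length ?\<alpha>) (sum_list ?\<alpha>).
        expansion_coeff v ?\<alpha> \<gamma> * insert_cup v k (mu v \<gamma>) u)"
      using insert by (simp add: insert_cup_sum)
    also have "\<dots> = (\<Sum>\<gamma>\<in>weight_words (length ?\<alpha>) (sum_list ?\<alpha>). ?g (insert_pair k 1 \<gamma>) + ?g (insert_pair k (-1) \<gamma>))"
      unfolding ins using insert.prems set
      by (intro sum.cong refl insert_cup_expansion_term[OF assms(2,3)]) (auto simp: weight_words_def words_def)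
    also have "\<dots> = (\<Sum>\<beta>\<in>weight_words (length ?\<alpha> + 2) (sum_list ?\<alpha>). ?g \<beta>)"
      by (rule sum_weight_words_insert_pair[symmetric]) (use zero in auto)
    also have "weight_words (length ?\<alpha> + 2) (sum_list ?\<alpha>) =
        weight_words (length (replicate k 1 @ [1, -1] @ \<alpha>)) (sum_list (replicate k 1 @ [1, -1] @ \<alpha>))"
      by simp
    finally show "eta v (replicate k 1 @ [1, -1] @ \<alpha>) u = (\<Sum>\<beta>\<in>weight_words
        (length (replicate k 1 @ [1, -1] @ \<alpha>)) (sum_list (replicate k 1 @ [1, -1] @ \<alpha>)). ?g \<beta>)" .
  qed
qed

lemma same_type_eq:
  assumes "one_factor \<alpha>"
  shows "same_type \<alpha> = {\<beta> \<in> weight_words (length \<alpha>) (sum_list \<alpha>). one_factor \<beta>}"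
  using sum_list_eq_pairings[OF assms] sum_list_eq_pairings one_factor_set
  by (auto simp: same_type_def weight_words_def words_def)

lemma is_expansion_expansion_coeff:
  assumes "one_factor \<alpha>" "v \<noteq> 0" "qfact v n \<noteq> 0" "length \<alpha> \<le> n"
  shows "is_expansion v \<alpha> (expansion_coeff v \<alpha>)"
  unfolding is_expansion_def eta_expansion_words[OF assms] same_type_eq[OF assms(1)]
  using mu_eq_0_if_not_one_factor[OF assms(2)]
  by (intro ext sum.mono_neutral_right finite_weight_words) (auto simp: weight_words_def words_def)

text \<open>
  The coefficients are determined by orthogonality and non-vanishing norms.
\<close>

lemma is_expansion_unique:
  assumes "one_factor \<alpha>" "v \<noteq> 0" "qfact v n \<noteq> 0" "length \<alpha> \<le> n"
    and "is_expansion v \<alpha> c" "\<beta> \<in> same_type \<alpha>"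
  shows "c \<beta> = form (length \<alpha>) (eta v \<alpha>) (mu v \<beta>) / form (length \<alpha>) (mu v \<beta>) (mu v \<beta>)"
proof -
  have \<beta>: "one_factor \<beta>" "length \<beta> = length \<alpha>" using assms(6) by (auto simp: same_type_def)
  have fin: "finite (same_type \<alpha>)"
    unfolding same_type_eq[OF assms(1)] by (simp add: finite_weight_words)
  have form: "form (length \<alpha>) (mu v \<gamma>) (mu v \<beta>) = (if \<gamma> = \<beta> then mu_norm v \<beta> else 0)" if "\<gamma> \<in> same_type \<alpha>" for \<gamma>
    using form_mu[OF assms(2), of \<gamma> \<beta>] that \<beta> one_factor_set by (auto simp: same_type_def)
  have "form (length \<alpha>) (eta v \<alpha>) (mu v \<beta>) = (\<Sum>\<gamma>\<in>same_type \<alpha>. c \<gamma> * (if \<gamma> = \<beta> then mu_norm v \<beta> else 0))"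
    using assms(5) unfolding is_expansion_def by (simp add: form_sum form)
  also have "\<dots> = (\<Sum>\<gamma>\<in>same_type \<alpha>. if \<gamma> = \<beta> then c \<beta> * mu_norm v \<beta> else 0)"
    by (intro sum.cong) auto
  also have "\<dots> = c \<beta> * mu_norm v \<beta>" using fin assms(6) by simp
  finally show ?thesis
    using form[OF assms(6)] mu_norm_nonzero[OF assms(2,3) \<beta>(1)] assms(4) \<beta>(2) by simp
qed

lemma trans_coeff_eq:
  assumes "one_factor \<alpha>" "v \<noteq> 0" "qfact v n \<noteq> 0" "length \<alpha> \<le> n"
    and "is_expansion v \<alpha> c" "\<beta> \<in> same_type \<alpha>"
  shows "trans_coeff v \<alpha> \<beta> = c \<beta>"
  unfolding trans_coeff_def using assms(5) is_expansion_unique[OF assms(1-4) _ assms(6)]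
  by (intro the_equality) metis+

lemma link_coeff_cases:
  assumes "qint v s \<noteq> 0" "qint v (s + 1) \<noteq> 0"
  shows "qint v (if a = 1 then - s else s + 1) / (qint v s * qint v (s + 1)) =
    (if a = 1 then -1 else 1) / qint v (if a = 1 then s + 1 else s)"
  using assms by (simp add: qint_minus)

theorem corollary5p6:
  fixes v :: "'k::field" and n m :: nat and \<alpha> \<beta> :: "int list"
  assumes "v \<noteq> 0"
    and "qfact v n \<noteq> 0"
    and "one_factor \<alpha>" and "one_factor \<beta>"
    and "length \<alpha> = length \<beta>" and "length \<alpha> \<le> n"
    and "card (pairings \<alpha>) = m" and "card (pairings \<beta>) = m"
  shows "is_expansion v \<alpha> (trans_coeff v \<alpha>)
    \<and> trans_coeff v \<alpha> \<beta> =
        form (length \<alpha>) (eta v \<alpha>) (mu v \<beta>) / form (length \<alpha>) (mu v \<beta>) (mu v \<beta>)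
    \<and> trans_coeff v \<alpha> \<beta> =
        (if compatible \<alpha> \<beta>
         then \<Prod>j=1..m. qint v (s'_seq \<alpha> \<beta> j) / (qint v (s_seq \<beta> j) * qint v (s_seq \<beta> j + 1))
         else 0)
    \<and> (compatible \<alpha> \<beta> \<longrightarrow>
        (\<exists>\<epsilon>\<in>{1, -1}. \<exists>t :: nat \<Rightarrow> int.
           (\<forall>j\<in>{1..m}. t j \<in> {s_seq \<beta> j, s_seq \<beta> j + 1} \<and> qint v (t j) \<noteq> 0) \<and>
           (\<Prod>j=1..m. qint v (s'_seq \<alpha> \<beta> j) / (qint v (s_seq \<beta> j) * qint v (s_seq \<beta> j + 1)))
             = \<epsilon> / (\<Prod>j=1..m. qint v (t j))))"
proof -
  note ctx = assms(3,1,2,6)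
  have exp: "is_expansion v \<alpha> (expansion_coeff v \<alpha>)"
    by (rule is_expansion_expansion_coeff[OF ctx])
  have \<beta>: "\<beta> \<in> same_type \<alpha>" using assms by (simp add: same_type_def)
  note trans = trans_coeff_eq[OF ctx exp]
  have m: "length (neg_positions \<beta>) = m" using assms(4,8) card_pairings by simp
  have "is_expansion v \<alpha> (trans_coeff v \<alpha>)"
    using exp trans unfolding is_expansion_def by (simp cong: sum.cong)
  moreover have "trans_coeff v \<alpha> \<beta> =
      form (length \<alpha>) (eta v \<alpha>) (mu v \<beta>) / form (length \<alpha>) (mu v \<beta>) (mu v \<beta>)"
    using trans[OF \<beta>] is_expansion_unique[OF ctx exp \<beta>] by simp
  moreover have "trans_coeff v \<alpha> \<beta> =
        (if compatible \<alpha> \<beta>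
         then \<Prod>j=1..m. qint v (s'_seq \<alpha> \<beta> j) / (qint v (s_seq \<beta> j) * qint v (s_seq \<beta> j + 1))
         else 0)"
    using trans[OF \<beta>] by (simp only: expansion_coeff_def coeff_prod_eq[OF m])
  moreover have "\<exists>\<epsilon>\<in>{1, -1}. \<exists>t :: nat \<Rightarrow> int.
      (\<forall>j\<in>{1..m}. t j \<in> {s_seq \<beta> j, s_seq \<beta> j + 1} \<and> qint v (t j) \<noteq> 0) \<and>
      (\<Prod>j=1..m. qint v (s'_seq \<alpha> \<beta> j) / (qint v (s_seq \<beta> j) * qint v (s_seq \<beta> j + 1)))
        = \<epsilon> / (\<Prod>j=1..m. qint v (t j))"
  proof -
    (* each factor equals -1/[s+1] or 1/[s], according to the entry of \<alpha> *)
    define a where "a j = \<alpha> ! (neg_positions \<beta> ! (j - 1))" for j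
    define t where "t j = (if a j = 1 then s_seq \<beta> j + 1 else s_seq \<beta> j)" for j
    define \<epsilon> :: 'k where "\<epsilon> = (\<Prod>j=1..m. if a j = 1 then -1 else 1)"
    have q: "qint v (s_seq \<beta> j) \<noteq> 0 \<and> qint v (s_seq \<beta> j + 1) \<noteq> 0" if "j \<in> {1..m}" for j
    proof -
      have "neg_positions \<beta> ! (j - 1) \<in> set (neg_positions \<beta>)" using that m by auto
      from neg_position_height[OF assms(4) this] show ?thesis
        using assms(5,6) qint_nonzero[OF assms(2), of "s_seq \<beta> j"] qint_nonzero[OF assms(2), of "s_seq \<beta> j + 1"]
        by (simp add: s_seq_def)
    qed
    have "(\<Prod>j\<in>A. if a j = 1 then -1 else 1) \<in> {1, -1 :: 'k}" for A
      by (induction A rule: infinite_finite_induct) auto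
    then have "\<epsilon> \<in> {1, -1}" by (simp add: \<epsilon>_def)
    moreover have "\<forall>j\<in>{1..m}. t j \<in> {s_seq \<beta> j, s_seq \<beta> j + 1} \<and> qint v (t j) \<noteq> 0"
      using q by (auto simp: t_def)
    moreover have "(\<Prod>j=1..m. qint v (s'_seq \<alpha> \<beta> j) / (qint v (s_seq \<beta> j) * qint v (s_seq \<beta> j + 1)))
        = \<epsilon> / (\<Prod>j=1..m. qint v (t j))"
      unfolding \<epsilon>_def prod_dividef[symmetric]
    proof (intro prod.cong refl)
      fix j assume "j \<in> {1..m}"
      then show "qint v (s'_seq \<alpha> \<beta> j) / (qint v (s_seq \<beta> j) * qint v (s_seq \<beta> j + 1)) =
          (if a j = 1 then -1 else 1) / qint v (t j)"
        unfolding s'_seq_def t_def a_def using q by (intro link_coeff_cases) blast+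
    qed
    ultimately show ?thesis by blast
  qed
  ultimately show ?thesis by blast
qed

end
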